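(* Let $K\subset\mathbb{C}$ be a smooth convex domain and let $1\le q<\infty$. Then there exists a constant $C_K>0$, depending only on $K$, such that $M_{n,q}(K)> C_K\, n$ for all $n\in\mathbb{N}$.
   Context: A convex domain is a compact convex subset $K\subset\mathbb{C}$ with nonempty interior; its boundary $\Gamma=\partial K$ is a rectifiable closed convex Jordan curve. $K$ is smooth if at every boundary point there is a unique supporting line to $K$. For $0<q<\infty$, $\|f\|_{L^q(\partial K)}=\left(\int_{\partial K}|f(z)|^q|dz|\right)^{1/q}$ (integration with respect to arc length). $\mathcal{P}_n(K)$ denotes the set of complex polynomials of degree exactly $n$ all of whose $n$ zeros lie in $K$. The oscillation factor is $M_{n,q}(K):=\inf_{p\in\mathcal{P}_n(K)} \|p'\|_{L^q(\partial K)}/\|p\|_{L^q(\partial K)}$. *)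

theory Defs
  imports "HOL-Analysis.Analysis" "HOL-Computational_Algebra.Polynomial"
begin

definition convex_domain :: "complex set \<Rightarrow> bool" where
  "convex_domain K \<longleftrightarrow> compact K \<and> convex K \<and> interior K \<noteq> {}"

definition supporting_line :: "complex set \<Rightarrow> complex \<Rightarrow> complex set \<Rightarrow> bool" where
  "supporting_line K z L \<longleftrightarrow> z \<in> L \<and>
     (\<exists>n c. n \<noteq> 0 \<and> L = {w. Re (w * cnj n) = c} \<and> (\<forall>w\<in>K. Re (w * cnj n) \<le> c))"

definition smooth_convex :: "complex set \<Rightarrow> bool" where
  "smooth_convex K \<longleftrightarrow> (\<forall>z\<in>frontier K. \<exists>!L. supporting_line K z L)"

text \<open>One-dimensional Hausdorff measure on the plane (arc length).\<close>
definition hausdorff1_delta :: "real \<Rightarrow> complex set \<Rightarrow> ennreal" where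
  "hausdorff1_delta \<delta> A =
     (INF C \<in> {C :: nat \<Rightarrow> complex set. A \<subseteq> (\<Union>i. C i) \<and>
                 (\<forall>i. bounded (C i) \<and> diameter (C i) \<le> \<delta>)}.
        (\<Sum>i. ennreal (diameter (C i))))"

definition hausdorff1_outer :: "complex set \<Rightarrow> ennreal" where
  "hausdorff1_outer A = (SUP \<delta> \<in> {0<..}. hausdorff1_delta \<delta> A)"

definition hausdorff1 :: "complex measure" where
  "hausdorff1 = measure_of UNIV (sets borel) hausdorff1_outer"

definition Lq_boundary_norm :: "complex set \<Rightarrow> real \<Rightarrow> (complex \<Rightarrow> complex) \<Rightarrow> real" where
  "Lq_boundary_norm K q f =
     (enn2real (\<integral>\<^sup>+ z\<in>frontier K. ennreal (cmod (f z) powr q) \<partial>hausdorff1)) powr (1 / q)"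

definition polys_in :: "nat \<Rightarrow> complex set \<Rightarrow> complex poly set" where
  "polys_in n K = {p. degree p = n \<and> (\<forall>z. poly p z = 0 \<longrightarrow> z \<in> K)}"

definition oscillation_factor :: "nat \<Rightarrow> real \<Rightarrow> complex set \<Rightarrow> real" where
  "oscillation_factor n q K =
     (INF p \<in> polys_in n K.
        Lq_boundary_norm K q (poly (pderiv p)) / Lq_boundary_norm K q (poly p))"

end

theory Submission
  imports Defs "HOL-Complex_Analysis.Complex_Analysis"
    "HOL-Computational_Algebra.Fundamental_Theorem_Algebra"
begin

text \<open>
  By smoothness and compactness there are \<open>h, \<rho> > 0\<close> such that for every boundary point \<open>\<zeta>\<close> the
  disc of radius \<open>\<rho>\<close> about the point at distance \<open>h\<close> on the inward normal lies in \<open>K\<close>. The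
  components of the terms \<open>1/(\<zeta> - z\<^sub>j)\<close> of \<open>p'(\<zeta>)/p(\<zeta>)\<close> along the normal all have the same sign, and they
  are bounded away from 0 for the zeros \<open>z\<^sub>j\<close> seen from \<open>\<zeta>\<close> at an angle bounded away from the tangent. If
  a fixed fraction of the zeros is of this kind, then \<open>|p'(\<zeta>)| \<ge> c n |p(\<zeta>)|\<close>. Otherwise almost
  all zeros are nearly tangential, the distance to each of them grows by a fixed factor from \<open>\<zeta>\<close> to the
  disc, and the other zeros spoil this only by a small power of a constant; hence \<open>p(\<zeta>)\<close> is
  exponentially small compared with \<open>M = max |p|\<close>. On the other hand, for any prescribed \<open>E > 1\<close>,
  Bernstein--Walsh on a normal segment gives \<open>|p| \<ge> M/2\<close> on a part of the boundary of length at
  least \<open>const * E ^ (-n)\<close>. For large \<open>n\<close> the second kind of boundary points is therefore negligible in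
  the norm of \<open>p\<close>. For the remaining finitely many \<open>n\<close> one compares \<open>max |p|\<close> with \<open>max |p'|\<close>.
\<close>

section \<open>One-dimensional Hausdorff measure\<close>

lemma hausdorff1_delta_le:
  assumes "A \<subseteq> (\<Union>i. C i)" "\<And>i. bounded (C i)" "\<And>i. diameter (C i) \<le> \<delta>"
  shows "hausdorff1_delta \<delta> A \<le> (\<Sum>i. ennreal (diameter (C i)))"
  unfolding hausdorff1_delta_def using assms by (intro INF_lower) auto

lemma hausdorff1_delta_approx:
  assumes "hausdorff1_delta \<delta> A < \<infinity>" "e > 0"
  obtains C where "A \<subseteq> (\<Union>i. C i)" "\<And>i. bounded (C i)" "\<And>i. diameter (C i) \<le> \<delta>"
    "(\<Sum>i. ennreal (diameter (C i))) \<le> hausdorff1_delta \<delta> A + ennreal e"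
proof -
  from INF_approx_ennreal[OF assms(2), of _ "\<lambda>C. \<Sum>i. ennreal (diameter (C i))", OF hausdorff1_delta_def[of \<delta> A]] assms(1)[THEN less_imp_neq]
  obtain C where "C \<in> {C :: nat \<Rightarrow> complex set. A \<subseteq> (\<Union>i. C i) \<and>
                 (\<forall>i. bounded (C i) \<and> diameter (C i) \<le> \<delta>)}"
    "(\<Sum>i. ennreal (diameter (C i))) < hausdorff1_delta \<delta> A + ennreal e"
    by blast
  then show ?thesis using that by (auto intro: less_imp_le)
qed

lemma hausdorff1_delta_mono:
  "A \<subseteq> B \<Longrightarrow> hausdorff1_delta \<delta> A \<le> hausdorff1_delta \<delta> B"
  unfolding hausdorff1_delta_def by (intro INF_superset_mono) auto

lemma hausdorff1_delta_antimono:
  "\<delta> \<le> \<epsilon> \<Longrightarrow> hausdorff1_delta \<epsilon> A \<le> hausdorff1_delta \<delta> A"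
  unfolding hausdorff1_delta_def by (intro INF_superset_mono) (auto intro: order_trans)

lemma hausdorff1_outer_mono: "A \<subseteq> B \<Longrightarrow> hausdorff1_outer A \<le> hausdorff1_outer B"
  unfolding hausdorff1_outer_def by (intro SUP_mono) (auto intro!: hausdorff1_delta_mono)

lemma hausdorff1_outer_empty [simp]: "hausdorff1_outer {} = 0"
proof -
  have "hausdorff1_delta \<delta> {} \<le> 0" if "\<delta> > 0" for \<delta>
    using hausdorff1_delta_le[of "{}" "\<lambda>_. {}" \<delta>] that by simp
  then show ?thesis unfolding hausdorff1_outer_def
    by (metis (mono_tags, lifting) SUP_least greaterThan_iff le_zero_eq)
qed

text \<open>At a fixed scale \<open>\<delta>\<close>, covers of the \<open>A i\<close> that are
  optimal up to \<open>e * (1/2) ^ Suc i\<close> merge into one sequence through the pairing of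
  indices; the errors add up to \<open>e\<close>.\<close>

lemma hausdorff1_delta_UN_le:
  assumes "\<delta> > 0"
  shows "hausdorff1_delta \<delta> (\<Union>i::nat. A i) \<le> (\<Sum>i. hausdorff1_delta \<delta> (A i))"
proof (rule ennreal_le_epsilon)
  fix e :: real assume "e > 0" and fin: "(\<Sum>i. hausdorff1_delta \<delta> (A i)) < top"
  have "\<exists>C. A i \<subseteq> (\<Union>j. C j) \<and> (\<forall>j. bounded (C j)) \<and> (\<forall>j. diameter (C j) \<le> \<delta>) \<and>
    (\<Sum>j. ennreal (diameter (C j))) \<le> hausdorff1_delta \<delta> (A i) + ennreal (e * (1/2) ^ Suc i)" for i :: nat
  proof -
    have "hausdorff1_delta \<delta> (A i) < \<infinity>"
      using ennreal_suminf_lessD[OF fin] by (simp add: infinity_ennreal_def)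
    moreover have "e * (1/2) ^ Suc i > 0" using \<open>e > 0\<close> by simp
    ultimately show ?thesis by (rule hausdorff1_delta_approx) blast
  qed
  then obtain C where C: "\<And>i. A i \<subseteq> (\<Union>j. C i j)" "\<And>i j. bounded (C i j)" "\<And>i j. diameter (C i j) \<le> \<delta>"
    "\<And>i. (\<Sum>j. ennreal (diameter (C i j))) \<le> hausdorff1_delta \<delta> (A i) + ennreal (e * (1/2) ^ Suc i)"
    by metis
  define D where "D k = (case prod_decode k of (i, j) \<Rightarrow> C i j)" for k
  have "(\<Union>i. A i) \<subseteq> (\<Union>k. D k)"
  proof
    fix x assume "x \<in> (\<Union>i. A i)"
    then obtain i j where "x \<in> C i j" using C(1) by blast
    then have "x \<in> D (prod_encode (i, j))" by (simp add: D_def)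
    then show "x \<in> (\<Union>k. D k)" by blast
  qed
  then have "hausdorff1_delta \<delta> (\<Union>i. A i) \<le> (\<Sum>k. ennreal (diameter (D k)))"
    by (rule hausdorff1_delta_le) (auto simp: D_def C split: prod.split)
  also have "\<dots> = (\<Sum>k. (\<lambda>(i, j). ennreal (diameter (C i j))) (prod_decode k))"
    by (intro suminf_cong) (auto simp: D_def split: prod.split)
  also have "\<dots> = (\<Sum>i. \<Sum>j. ennreal (diameter (C i j)))"
    by (rule suminf_ennreal_2dimen) simp
  also have "\<dots> \<le> (\<Sum>i. hausdorff1_delta \<delta> (A i) + ennreal (e * (1/2) ^ Suc i))"
    using C(4) by (intro suminf_le summableI) auto
  also have "\<dots> = (\<Sum>i. hausdorff1_delta \<delta> (A i)) + (\<Sum>i. ennreal (e * (1/2) ^ Suc i))"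
    by (intro suminf_add[symmetric] summableI)
  also have "(\<Sum>i. ennreal (e * (1/2) ^ Suc i)) = ennreal e"
  proof -
    have "(\<lambda>i. e * (1/2) ^ Suc i) sums (e * 1)"
      by (intro sums_mult power_half_series)
    then have "(\<lambda>i. ennreal (e * (1/2) ^ Suc i)) sums ennreal e"
      using \<open>e > 0\<close> by (subst sums_ennreal) auto
    then show ?thesis by (rule sums_unique[symmetric])
  qed
  finally show "hausdorff1_delta \<delta> (\<Union>i. A i) \<le> (\<Sum>i. hausdorff1_delta \<delta> (A i)) + ennreal e" .
qed

lemma hausdorff1_delta_le_outer: "\<delta> > 0 \<Longrightarrow> hausdorff1_delta \<delta> A \<le> hausdorff1_outer A"
  unfolding hausdorff1_outer_def by (rule SUP_upper) auto

lemma hausdorff1_outer_UN_le: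
  "hausdorff1_outer (\<Union>i::nat. A i) \<le> (\<Sum>i. hausdorff1_outer (A i))"
proof -
  have "hausdorff1_delta \<delta> (\<Union>i. A i) \<le> (\<Sum>i. hausdorff1_outer (A i))" if "\<delta> > 0" for \<delta>
    using hausdorff1_delta_UN_le[OF that, of A]
    by (rule order_trans) (intro suminf_le summableI hausdorff1_delta_le_outer that)
  then show ?thesis
    unfolding hausdorff1_outer_def[of "\<Union>i. A i"] by (intro SUP_least) auto
qed

lemma outer_measure_space_hausdorff1: "outer_measure_space UNIV hausdorff1_outer"
  unfolding outer_measure_space_def positive_def increasing_def countably_subadditive_def
  by (auto intro: hausdorff1_outer_mono hausdorff1_outer_UN_le)

lemma hausdorff1_outer_Un_le:
  "hausdorff1_outer (A \<union> B) \<le> hausdorff1_outer A + hausdorff1_outer B"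
proof -
  let ?F = "\<lambda>i::nat. if i = 0 then A else if i = 1 then B else {}"
  have "hausdorff1_outer (\<Union>i. ?F i) \<le> (\<Sum>i. hausdorff1_outer (?F i))"
    by (rule hausdorff1_outer_UN_le)
  also have "(\<Union>i. ?F i) = A \<union> B" by (auto split: if_splits)
  also have "(\<Sum>i. hausdorff1_outer (?F i)) = (\<Sum>i\<in>{0,1}. hausdorff1_outer (?F i))"
    by (rule suminf_finite) auto
  finally show ?thesis by simp
qed

text \<open>No set of diameter below \<open>r\<close> meets both \<open>A\<close> and
  \<open>B\<close>, so every sufficiently fine cover of the union splits into a cover of
  \<open>A\<close> and a disjoint family covering \<open>B\<close>.\<close>

lemma hausdorff1_outer_separated:
  assumes "r > 0" and sep: "\<And>x y. x \<in> A \<Longrightarrow> y \<in> B \<Longrightarrow> r \<le> dist x y"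
  shows "hausdorff1_outer A + hausdorff1_outer B \<le> hausdorff1_outer (A \<union> B)"
proof -
  have *: "hausdorff1_delta \<delta> A + hausdorff1_delta \<delta> B \<le> hausdorff1_delta \<delta> (A \<union> B)"
    if "0 < \<delta>" "\<delta> < r" for \<delta>
    unfolding hausdorff1_delta_def[of \<delta> "A \<union> B"]
  proof (rule INF_greatest, clarify)
    fix C :: "nat \<Rightarrow> complex set"
    assume C: "A \<union> B \<subseteq> (\<Union>i. C i)" "\<forall>i. bounded (C i) \<and> diameter (C i) \<le> \<delta>"
    define CA where "CA i = (if C i \<inter> A = {} then {} else C i)" for i
    define CB where "CB i = (if C i \<inter> B = {} then {} else C i)" for i
    have "hausdorff1_delta \<delta> A \<le> (\<Sum>i. ennreal (diameter (CA i)))"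
      using C that(1) by (intro hausdorff1_delta_le) (auto simp: CA_def; blast)+
    moreover have "hausdorff1_delta \<delta> B \<le> (\<Sum>i. ennreal (diameter (CB i)))"
      using C that(1) by (intro hausdorff1_delta_le) (auto simp: CB_def; blast)+
    ultimately have "hausdorff1_delta \<delta> A + hausdorff1_delta \<delta> B \<le>
        (\<Sum>i. ennreal (diameter (CA i)) + ennreal (diameter (CB i)))"
      by (subst suminf_add[symmetric]) (auto intro: add_mono)
    also have "\<dots> \<le> (\<Sum>i. ennreal (diameter (C i)))"
    proof (intro suminf_le summableI)
      fix i
      have "C i \<inter> A = {} \<or> C i \<inter> B = {}"
      proof (rule ccontr)
        assume "\<not> ?thesis"
        then obtain x y where "x \<in> C i" "x \<in> A" "y \<in> C i" "y \<in> B" by blast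
        then have "r \<le> dist x y" "dist x y \<le> diameter (C i)"
          using sep C(2) by (auto intro: diameter_bounded_bound)
        then show False using C(2) that by (metis leD le_less_trans order_trans)
      qed
      then show "ennreal (diameter (CA i)) + ennreal (diameter (CB i)) \<le> ennreal (diameter (C i))"
        by (auto simp: CA_def CB_def)
    qed
    finally show "hausdorff1_delta \<delta> A + hausdorff1_delta \<delta> B \<le> (\<Sum>i. ennreal (diameter (C i)))" .
  qed
  \<comment> \<open>Both suprema are limits along the same monotone family as
    \<open>\<delta>\<close> decreases, so they may be added inside a single supremum.\<close>
  have "hausdorff1_outer A + hausdorff1_outer B =
      (SUP \<delta>\<in>{0<..}. hausdorff1_delta \<delta> A + hausdorff1_delta \<delta> B)"
    unfolding hausdorff1_outer_def
  proof (rule SUP_add_directed_ennreal[symmetric])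
    fix i j :: real assume "i \<in> {0<..}" "j \<in> {0<..}"
    then show "\<exists>k\<in>{0<..}. hausdorff1_delta i A + hausdorff1_delta j B
        \<le> hausdorff1_delta k A + hausdorff1_delta k B"
      by (intro bexI[of _ "min i j"] add_mono hausdorff1_delta_antimono) auto
  qed
  also have "\<dots> \<le> hausdorff1_outer (A \<union> B)"
  proof (rule SUP_least)
    fix \<delta> :: real assume "\<delta> \<in> {0<..}"
    define \<epsilon> where "\<epsilon> = min \<delta> (r/2)"
    have \<epsilon>: "0 < \<epsilon>" "\<epsilon> < r" "\<epsilon> \<le> \<delta>" using \<open>\<delta> \<in> _\<close> \<open>r > 0\<close> by (auto simp: \<epsilon>_def)
    have "hausdorff1_delta \<delta> A + hausdorff1_delta \<delta> B \<le> hausdorff1_delta \<epsilon> A + hausdorff1_delta \<epsilon> B"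
      by (intro add_mono hausdorff1_delta_antimono \<epsilon>)
    also have "\<dots> \<le> hausdorff1_outer (A \<union> B)"
      using *[OF \<epsilon>(1,2)] hausdorff1_delta_le_outer[OF \<epsilon>(1), of "A \<union> B"] by (rule order_trans)
    finally show "hausdorff1_delta \<delta> A + hausdorff1_delta \<delta> B \<le> hausdorff1_outer (A \<union> B)" .
  qed
  finally show ?thesis .
qed

text \<open>The function \<open>u\<close> arranges the sets in descending slabs with positive gaps.
  Being 1-Lipschitz, it turns a gap between values into a distance between points, so the sets can
  be split off one at a time.\<close>

lemma hausdorff1_outer_sum_separated:
  fixes u :: "complex \<Rightarrow> real" and l r :: "nat \<Rightarrow> real"
  assumes lip: "\<And>x y. \<bar>u x - u y\<bar> \<le> dist x y"
    and S: "\<And>i x. x \<in> S i \<Longrightarrow> l i \<le> u x \<and> u x \<le> r i"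
    and gap: "\<And>i. r (Suc i) < l i" and lr: "\<And>i. l i \<le> r i"
  shows "(\<Sum>i<n. hausdorff1_outer (S i)) \<le> hausdorff1_outer (\<Union>i<n. S i)"
proof (induction n)
  case (Suc n)
  have l_anti: "l m \<le> l k" if "k \<le> m" for k m
    using that by (rule lift_Suc_antimono_le[rotated]) (use gap lr in \<open>metis less_imp_le order_trans\<close>)
  show ?case
  proof (cases "n = 0")
    case False
    then obtain m where m: "n = Suc m" using not0_implies_Suc by blast
    have "(\<Sum>i<Suc n. hausdorff1_outer (S i)) \<le> hausdorff1_outer (\<Union>i<n. S i) + hausdorff1_outer (S n)"
      using Suc by (simp add: add_right_mono)
    also have "\<dots> \<le> hausdorff1_outer ((\<Union>i<n. S i) \<union> S n)"
    proof (rule hausdorff1_outer_separated)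
      show "0 < l m - r n" using gap[of m] m by simp
    next
      fix x y assume "x \<in> (\<Union>i<n. S i)" "y \<in> S n"
      then obtain i where i: "i < n" "x \<in> S i" by blast
      then have "l m \<le> u x" using S[OF i(2)] l_anti[of i m] m by auto
      moreover have "u y \<le> r n" using S \<open>y \<in> S n\<close> by blast
      ultimately show "l m - r n \<le> dist x y" using lip[of x y] by linarith
    qed
    also have "(\<Union>i<n. S i) \<union> S n = (\<Union>i<Suc n. S i)" by (auto simp: less_Suc_eq)
    finally show ?thesis .
  qed (simp add: lessThan_Suc)
qed simp

lemma hausdorff1_outer_sum_le:
  assumes "\<And>n. (\<Sum>i<n. hausdorff1_outer (S i)) \<le> hausdorff1_outer (\<Union>i<n. S i)"
    "\<And>i. S i \<subseteq> A"
  shows "(\<Sum>i. hausdorff1_outer (S i)) \<le> hausdorff1_outer A"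
proof (rule suminf_le_const[OF summableI])
  fix n
  have "hausdorff1_outer (\<Union>i<n. S i) \<le> hausdorff1_outer A"
    using assms(2) by (intro hausdorff1_outer_mono) auto
  then show "(\<Sum>i<n. hausdorff1_outer (S i)) \<le> hausdorff1_outer A"
    using assms(1) order_trans by blast
qed

section \<open>Caratheodory's criterion and the resulting Borel measure\<close>

lemma ennreal_suminf_tail_le:
  fixes f :: "nat \<Rightarrow> ennreal"
  assumes "(\<Sum>i. f i) < top" "e > 0"
  shows "\<exists>n. (\<Sum>i. f (i + n)) \<le> ennreal e"
proof -
  have fin: "f i < top" for i using ennreal_suminf_lessD[OF assms(1)] .
  define g where "g i = enn2real (f i)" for i
  have fg: "f i = ennreal (g i)" for i using fin by (simp add: g_def)
  have g0: "g i \<ge> 0" for i by (simp add: g_def)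
  have "summable g"
    using assms(1) g0 by (intro summable_suminf_not_top) (auto simp: fg)
  then obtain n where n: "norm (\<Sum>i. g (i + n)) < e"
    using suminf_exist_split[OF assms(2)] by blast
  have "(\<Sum>i. f (i + n)) = ennreal (\<Sum>i. g (i + n))"
    unfolding fg using \<open>summable g\<close> g0
    by (intro suminf_ennreal2) (auto simp: summable_iff_shift)
  then show ?thesis using n by (intro exI[of _ n]) (auto intro!: ennreal_leI)
qed

text \<open>Caratheodory's criterion: the part of \<open>A\<close> off \<open>F\<close> is exhausted by rings around \<open>F\<close>;
  every second ring is separated from the others, so the rings have finite total measure.\<close>
lemma hausdorff1_outer_closed_split:
  assumes "closed F"
  shows "hausdorff1_outer (A \<inter> F) + hausdorff1_outer (A - F) = hausdorff1_outer A"
proof (rule antisym)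
  have "hausdorff1_outer ((A \<inter> F) \<union> (A - F)) \<le> hausdorff1_outer (A \<inter> F) + hausdorff1_outer (A - F)"
    by (rule hausdorff1_outer_Un_le)
  then show "hausdorff1_outer A \<le> hausdorff1_outer (A \<inter> F) + hausdorff1_outer (A - F)"
    by (simp add: Int_Diff_Un)
next
  show "hausdorff1_outer (A \<inter> F) + hausdorff1_outer (A - F) \<le> hausdorff1_outer A"
  proof (cases "F = {} \<or> hausdorff1_outer A = top")
    case True then show ?thesis by auto
  next
    case False
    define u where "u x = infdist x F" for x
    have lip: "\<bar>u x - u y\<bar> \<le> dist x y" for x y
      unfolding u_def by (rule infdist_triangle_abs)
    have upos: "u x > 0 \<longleftrightarrow> x \<notin> F" for x
      using False assms infdist_nonneg[of x F] by (auto simp: u_def in_closed_iff_infdist_zero less_le)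
    define B where "B k = {x\<in>A. inverse (real (Suc k)) < u x}" for k
    define R where "R k = {x\<in>A. inverse (real (Suc (Suc k))) < u x \<and> u x \<le> inverse (real (Suc k))}" for k
    have S: "(\<Sum>i. hausdorff1_outer (R (2 * i + j))) \<le> hausdorff1_outer A" for j
    proof (rule hausdorff1_outer_sum_le)
      show "(\<Sum>i<n. hausdorff1_outer (R (2 * i + j))) \<le> hausdorff1_outer (\<Union>i<n. R (2 * i + j))" for n
        by (rule hausdorff1_outer_sum_separated[where u = u and
             l = "\<lambda>i. inverse (real (Suc (Suc (2*i+j))))" and r = "\<lambda>i. inverse (real (Suc (2*i+j)))"])
           (auto simp: R_def lip intro!: le_imp_inverse_le)
      show "R (2 * i + j) \<subseteq> A" for i by (auto simp: R_def)
    qed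
    have "(\<Sum>i. hausdorff1_outer (R i)) = (\<Sum>i. hausdorff1_outer (R (2*i)) + hausdorff1_outer (R (2*i+1)))"
    proof -
      have "(\<lambda>i. sum (\<lambda>i. hausdorff1_outer (R i)) {i*2..<i*2+2}) sums (\<Sum>i. hausdorff1_outer (R i))"
        by (rule sums_group[OF summable_sums[OF summableI]]) simp
      moreover have "sum (\<lambda>i. hausdorff1_outer (R i)) {i*2..<i*2+2} =
         hausdorff1_outer (R (2*i)) + hausdorff1_outer (R (2*i+1))" for i
        by (simp add: numeral_2_eq_2 mult.commute)
      ultimately show ?thesis by (simp add: sums_iff)
    qed
    also have "\<dots> = (\<Sum>i. hausdorff1_outer (R (2*i))) + (\<Sum>i. hausdorff1_outer (R (2*i+1)))"
      by (intro suminf_add[symmetric] summableI)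
    also have "\<dots> \<le> hausdorff1_outer A + hausdorff1_outer A"
      using S[of 0] S[of 1] by (intro add_mono) auto
    also have "\<dots> < top" using False by (simp add: less_top)
    finally have fin: "(\<Sum>i. hausdorff1_outer (R i)) < top" .
    show ?thesis
    proof (rule ennreal_le_epsilon)
      fix e :: real assume "e > 0"
      from ennreal_suminf_tail_le[OF fin this] obtain k
        where k: "(\<Sum>i. hausdorff1_outer (R (i + k))) \<le> ennreal e" by blast
      have "A - F \<subseteq> B k \<union> (\<Union>i. R (i + k))"
      proof
        fix x assume x: "x \<in> A - F"
        then have "u x > 0" using upos by blast
        have ex: "\<exists>n. inverse (real (Suc n)) < u x"
          using reals_Archimedean[OF \<open>u x > 0\<close>] by auto
        \<comment> \<open>If \<open>n > k\<close>, minimality of \<open>n\<close> puts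
          \<open>x\<close> into the ring of index \<open>n - 1\<close>, because \<open>R m\<close>
          lies between the levels of index \<open>m\<close> and \<open>Suc m\<close>.\<close>
        define n where "n = (LEAST n. inverse (real (Suc n)) < u x)"
        have n: "inverse (real (Suc n)) < u x" unfolding n_def by (rule LeastI_ex[OF ex])
        show "x \<in> B k \<union> (\<Union>i. R (i + k))"
        proof (cases "n \<le> k")
          case True
          then have "inverse (real (Suc k)) \<le> inverse (real (Suc n))" by (intro le_imp_inverse_le) auto
          then have "inverse (real (Suc k)) < u x" using n by (rule le_less_trans)
          then show ?thesis using x by (simp add: B_def)
        next
          case False
          then obtain m where m: "n = Suc m" "k \<le> m" by (cases n) auto
          then have "\<not> inverse (real (Suc m)) < u x"
            using not_less_Least[of m "\<lambda>n. inverse (real (Suc n)) < u x"] by (simp add: n_def)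
          then have "x \<in> R (m - k + k)" using n m x by (simp add: R_def)
          then show ?thesis by blast
        qed
      qed
      then have "hausdorff1_outer (A - F) \<le> hausdorff1_outer (B k) + hausdorff1_outer (\<Union>i. R (i + k))"
        using hausdorff1_outer_mono hausdorff1_outer_Un_le order_trans by blast
      also have "\<dots> \<le> hausdorff1_outer (B k) + ennreal e"
        using hausdorff1_outer_UN_le[of "\<lambda>i. R (i+k)"] k by (intro add_left_mono) (rule order_trans)
      finally have "hausdorff1_outer (A \<inter> F) + hausdorff1_outer (A - F)
          \<le> (hausdorff1_outer (A \<inter> F) + hausdorff1_outer (B k)) + ennreal e"
        by (metis add.assoc add_left_mono)
      \<comment> \<open>Points of \<open>B k\<close> keep the distance
        \<open>inverse (real (Suc k))\<close> from \<open>F\<close>, so the separated case applies;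
        only the tail of rings, of measure at most \<open>e\<close>, has been given up.\<close>
      also have "hausdorff1_outer (A \<inter> F) + hausdorff1_outer (B k) \<le> hausdorff1_outer ((A \<inter> F) \<union> B k)"
      proof (rule hausdorff1_outer_separated)
        fix x y assume "x \<in> A \<inter> F" "y \<in> B k"
        then show "inverse (real (Suc k)) \<le> dist x y"
          using lip[of x y] upos[of x] infdist_nonneg[of x F] by (auto simp: B_def u_def)
      qed simp
      also have "\<dots> \<le> hausdorff1_outer A"
        by (rule hausdorff1_outer_mono) (auto simp: B_def)
      finally show "hausdorff1_outer (A \<inter> F) + hausdorff1_outer (A - F) \<le> hausdorff1_outer A + ennreal e"
        by (simp add: add_right_mono)
    qed
  qed
qed

text \<open>Without this fact \<^const>\<open>measure_of\<close> would yield the null measure.\<close>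
lemma measure_space_hausdorff1: "measure_space UNIV (sets borel) hausdorff1_outer"
proof -
  interpret P: sigma_algebra "UNIV :: complex set" UNIV
    using sigma_algebra_Pow[of UNIV] by simp
  let ?L = "lambda_system UNIV UNIV hausdorff1_outer"
  have ms: "measure_space UNIV ?L hausdorff1_outer"
    by (rule P.caratheodory_lemma[OF outer_measure_space_hausdorff1])
  interpret L: sigma_algebra UNIV ?L using ms by (simp add: measure_space_def)
  have "{F :: complex set. closed F} \<subseteq> ?L"
    by (auto simp: P.lambda_system_eq hausdorff1_outer_closed_split)
  then have "sigma_sets UNIV {F :: complex set. closed F} \<subseteq> ?L"
    by (rule L.sigma_sets_subset)
  moreover have "sets borel = sigma_sets UNIV {F :: complex set. closed F}"
    by (simp add: borel_eq_closed)
  ultimately have "sets borel \<subseteq> ?L" by simp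
  then show ?thesis
    using measure_down[OF ms] sets.sigma_algebra_axioms[of borel] by (simp add: space_borel)
qed

lemma space_hausdorff1 [simp]: "space hausdorff1 = UNIV"
  unfolding hausdorff1_def by (rule space_measure_of) auto

lemma sets_hausdorff1 [simp, measurable_cong]: "sets hausdorff1 = sets borel"
  unfolding hausdorff1_def
  by (metis sets.sigma_sets_eq sets_measure_of space_borel subset_UNIV Pow_UNIV)

lemma emeasure_hausdorff1: "A \<in> sets borel \<Longrightarrow> emeasure hausdorff1 A = hausdorff1_outer A"
  unfolding hausdorff1_def using measure_space_hausdorff1
  by (intro emeasure_measure_of_sigma) (auto simp: measure_space_def)

section \<open>Comparison with length on the line through Lipschitz maps\<close>

text \<open>A 1-Lipschitz map does not increase diameters, so every cover of \<open>A\<close> yields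
  intervals of no greater total length that cover \<open>{0<..<t}\<close>.\<close>

lemma hausdorff1_outer_lipschitz_lower:
  fixes f :: "complex \<Rightarrow> real"
  assumes lip: "\<And>x y. \<bar>f x - f y\<bar> \<le> dist x y" and t: "0 \<le> t" and sub: "{0<..<t} \<subseteq> f ` A"
  shows "ennreal t \<le> hausdorff1_outer A"
proof -
  have "ennreal t \<le> hausdorff1_delta 1 A"
    unfolding hausdorff1_delta_def
  proof (rule INF_greatest, clarify)
    fix C :: "nat \<Rightarrow> complex set"
    assume C: "A \<subseteq> (\<Union>i. C i)" "\<forall>i. bounded (C i) \<and> diameter (C i) \<le> 1"
    \<comment> \<open>The closed hull of the image is taken, since the image itself need not be
      Borel; its length is still at most the diameter.\<close>
    define J where "J i = (if C i = {} then {} else {Inf (f ` C i)..Sup (f ` C i)})" for i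
    have bd: "f x \<in> J i \<and> Sup (f ` C i) - Inf (f ` C i) \<le> diameter (C i)" if "x \<in> C i" for x i
    proof -
      have b: "\<bar>f y - f z\<bar> \<le> diameter (C i)" if "y \<in> C i" "z \<in> C i" for y z
        using lip[of y z] diameter_bounded_bound[of "C i" y z] C(2) that by force
      have ba: "bdd_above (f ` C i)" using b[OF _ \<open>x \<in> C i\<close>]
        by (intro bdd_aboveI2[of _ _ "f x + diameter (C i)"]) force
      have bb: "bdd_below (f ` C i)" using b[OF _ \<open>x \<in> C i\<close>]
        by (intro bdd_belowI2[of _ "f x - diameter (C i)"]) force
      have "Sup (f ` C i) \<le> Inf (f ` C i) + diameter (C i)"
      proof (rule cSUP_least)
        fix y assume y: "y \<in> C i"
        have "f y - diameter (C i) \<le> Inf (f ` C i)"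
          using b[OF y] \<open>x \<in> C i\<close> by (intro cINF_greatest) force+
        then show "f y \<le> Inf (f ` C i) + diameter (C i)" by simp
      qed (use \<open>x \<in> C i\<close> in auto)
      then show ?thesis using that ba bb by (auto simp: J_def intro: cINF_lower cSUP_upper)
    qed
    have "{0<..<t} \<subseteq> (\<Union>i. J i)"
    proof
      fix s assume "s \<in> {0<..<t}"
      then obtain x where "x \<in> A" "s = f x" using sub by blast
      then obtain i where "x \<in> C i" using C(1) by blast
      then show "s \<in> (\<Union>i. J i)" using bd \<open>s = f x\<close> by blast
    qed
    then have "emeasure lborel {0<..<t} \<le> emeasure lborel (\<Union>i. J i)"
      by (intro emeasure_mono) (auto simp: J_def)
    also have "\<dots> \<le> (\<Sum>i. emeasure lborel (J i))"
      by (rule emeasure_subadditive_countably) (auto simp: J_def)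
    also have "\<dots> \<le> (\<Sum>i. ennreal (diameter (C i)))"
    proof (intro suminf_le summableI)
      fix i
      show "emeasure lborel (J i) \<le> ennreal (diameter (C i))"
      proof (cases "C i = {}")
        case False
        then obtain x where "x \<in> C i" by blast
        have "Inf (f ` C i) \<le> Sup (f ` C i)"
          using bd[OF \<open>x \<in> C i\<close>] False by (auto simp: J_def)
        then show ?thesis using bd[OF \<open>x \<in> C i\<close>] False by (auto simp: J_def intro: ennreal_leI)
      qed (simp add: J_def)
    qed
    finally show "ennreal t \<le> (\<Sum>i. ennreal (diameter (C i)))" using t by simp
  qed
  also have "\<dots> \<le> hausdorff1_outer A" by (rule hausdorff1_delta_le_outer) simp
  finally show ?thesis .
qed

text \<open>Cutting the parameter interval into \<open>N\<close> equal pieces gives covers at every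
  scale whose diameters add up to at most \<open>L * b\<close>.\<close>

lemma hausdorff1_outer_lipschitz_upper:
  fixes g :: "real \<Rightarrow> complex"
  assumes lip: "\<And>s t. dist (g s) (g t) \<le> L * \<bar>s - t\<bar>" and b: "0 \<le> b" and L: "0 \<le> L"
    and sub: "A \<subseteq> g ` {0..b}"
  shows "hausdorff1_outer A \<le> ennreal (L * b)"
  unfolding hausdorff1_outer_def
proof (rule SUP_least)
  fix \<delta> :: real assume "\<delta> \<in> {0<..}"
  then have \<delta>: "\<delta> > 0" by simp
  obtain N :: nat where N: "L * b / \<delta> < real N" using reals_Archimedean2 by blast
  have N0: "real N > 0" using N b L \<delta> by (meson divide_nonneg_pos le_less_trans mult_nonneg_nonneg)
  define J where "J i = {real i * (b / N) .. real (Suc i) * (b / N)}" for i :: nat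
  define C where "C i = (if i < N then g ` J i else {})" for i
  have dC: "dist x y \<le> L * b / N" if "x \<in> C i" "y \<in> C i" for x y i
  proof -
    from that obtain s t where st: "s \<in> J i" "t \<in> J i" "x = g s" "y = g t"
      by (auto simp: C_def split: if_splits)
    have "\<bar>s - t\<bar> \<le> b / N" using st(1,2) by (auto simp: J_def algebra_simps add_divide_distrib)
    then have "L * \<bar>s - t\<bar> \<le> L * (b / N)" using L by (rule mult_left_mono)
    then show ?thesis using lip[of s t] st by simp
  qed
  have diam: "diameter (C i) \<le> (if i < N then L * b / N else 0)" for i
    using dC[of _ i] b L by (cases "i < N") (auto intro!: diameter_le simp: dist_norm, auto simp: C_def)
  have "bounded (C i)" for i
    using dC unfolding bounded_two_points by blast
  moreover have "diameter (C i) \<le> \<delta>" for i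
  proof -
    have "L * b / N \<le> \<delta>" using N N0 \<delta> by (simp add: field_simps)
    then show ?thesis using diam[of i] \<delta> by (auto split: if_splits)
  qed
  moreover have "A \<subseteq> (\<Union>i. C i)"
  proof
    fix x assume "x \<in> A"
    then obtain s where s: "x = g s" "0 \<le> s" "s \<le> b" using sub by auto
    show "x \<in> (\<Union>i. C i)"
    \<comment> \<open>The floor formula below divides by \<open>b\<close>, and for
      \<open>s = b > 0\<close> it would give the index \<open>N\<close>, one too many; this point
      goes to the last piece.\<close>
    proof (cases "s = b")
      case True
      have "b \<in> J (N - 1)" using N0 b by (auto simp: J_def field_simps)
      then have "x \<in> C (N - 1)" using True s N0 by (auto simp: C_def)
      then show ?thesis by blast
    next
      case False
      then have "b > 0" "s < b" using s by auto
      define i where "i = nat \<lfloor>s * N / b\<rfloor>"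
      have "s * N / b \<ge> 0" using s N0 \<open>b > 0\<close> by simp
      then have i: "real i \<le> s * N / b" "s * N / b < real i + 1"
        unfolding i_def by linarith+
      then have "s \<in> J i" using N0 \<open>b > 0\<close> by (auto simp: J_def field_simps)
      have "s * N / b < N" using N0 \<open>b > 0\<close> \<open>s < b\<close> by (simp add: field_simps)
      then have "i < N" using i(1) by linarith
      then have "x \<in> C i" using \<open>s \<in> J i\<close> s by (auto simp: C_def)
      then show ?thesis by blast
    qed
  qed
  ultimately have "hausdorff1_delta \<delta> A \<le> (\<Sum>i. ennreal (diameter (C i)))"
    by (intro hausdorff1_delta_le) auto
  also have "\<dots> \<le> (\<Sum>i. ennreal (if i < N then L * b / N else 0))"
    by (intro suminf_le summableI ennreal_leI diam)
  also have "\<dots> = (\<Sum>i<N. ennreal (if i < N then L * b / N else 0))"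
    by (rule suminf_finite) auto
  also have "\<dots> = ennreal (\<Sum>i<N. L * b / N)"
    using L b by (subst sum_ennreal[symmetric]) auto
  also have "(\<Sum>i<N. L * b / N) = L * b" using N0 by simp
  finally show "hausdorff1_delta \<delta> A \<le> ennreal (L * b)" .
qed

section \<open>Polynomials\<close>

text \<open>Maximum principle for the reversed polynomial, whose value at 0 is 1.\<close>
lemma exists_prod_dist_ge:
  fixes z :: "'i \<Rightarrow> complex"
  assumes "finite I" "\<rho> > 0"
  shows "\<exists>y\<in>cball a \<rho>. \<rho> ^ card I \<le> (\<Prod>i\<in>I. cmod (y - z i))"
proof -
  \<comment> \<open>The substitution \<open>y = a + 1/w\<close> exchanges the circle of radius
    \<open>1/\<rho>\<close> about 0 and the circle of radius \<open>\<rho>\<close> about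
    \<open>a\<close>; up to the factor \<open>w ^ card I\<close>, \<open>F w\<close> is the product
    of the \<open>y - z i\<close>.\<close>
  define F where "F w = (\<Prod>i\<in>I. 1 - w * (z i - a))" for w
  have cont: "continuous_on S F" and hol: "F holomorphic_on S" for S
    unfolding F_def by (intro continuous_intros holomorphic_intros)+
  have "\<exists>w\<in>sphere 0 (1/\<rho>). \<forall>v\<in>sphere 0 (1/\<rho>). cmod (F v) \<le> cmod (F w)"
    using assms(2) by (intro continuous_attains_sup continuous_on_norm cont) auto
  then obtain w where w: "cmod w = 1/\<rho>" "\<And>v. cmod v = 1/\<rho> \<Longrightarrow> cmod (F v) \<le> cmod (F w)"
    by auto
  have "cmod (F 0) \<le> cmod (F w)"
    by (rule maximum_modulus_frontier[of F "cball 0 (1/\<rho>)"]) (use hol cont w assms in auto)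
  then have F1: "1 \<le> cmod (F w)" by (simp add: F_def)
  have w0: "w \<noteq> 0" using w(1) assms(2) by auto
  have "cmod (a + 1/w - z i) = \<rho> * cmod (1 - w * (z i - a))" for i
  proof -
    have "a + 1/w - z i = (1 - w * (z i - a)) / w" using w0 by (simp add: field_simps)
    then show ?thesis using w(1) assms(2) by (simp add: norm_divide)
  qed
  then have "(\<Prod>i\<in>I. cmod (a + 1/w - z i)) = \<rho> ^ card I * cmod (F w)"
    by (simp add: F_def prod.distrib prod_norm)
  moreover have "\<rho> ^ card I * 1 \<le> \<rho> ^ card I * cmod (F w)"
    using F1 assms by (intro mult_left_mono) auto
  moreover have "a + 1/w \<in> cball a \<rho>" using w(1) by (simp add: dist_norm norm_divide)
  ultimately show ?thesis by (intro bexI[of _ "a + 1/w"]) auto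
qed

lemma poly_pderiv_prod_linear:
  fixes z :: "'i \<Rightarrow> 'a :: field"
  assumes "finite I" "\<And>i. i \<in> I \<Longrightarrow> x \<noteq> z i"
  shows "poly (pderiv (\<Prod>i\<in>I. [:- z i, 1:])) x = (\<Prod>i\<in>I. x - z i) * (\<Sum>i\<in>I. 1 / (x - z i))"
  using assms
proof (induction I rule: finite_induct)
  case (insert j I)
  have "x - z j \<noteq> 0" using insert.prems by auto
  define P where "P = (\<Prod>i\<in>I. [:- z i, 1:])"
  have "poly P x = (\<Prod>i\<in>I. x - z i)" by (simp add: P_def poly_prod)
  moreover have "poly (pderiv P) x = (\<Prod>i\<in>I. x - z i) * (\<Sum>i\<in>I. 1 / (x - z i))"
    unfolding P_def using insert by auto
  moreover have "poly (pderiv ([:- z j, 1:] * P)) x = (x - z j) * poly (pderiv P) x + poly P x"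
    by (simp only: pderiv_mult) (simp add: pderiv_pCons algebra_simps)
  moreover have "(\<Prod>i\<in>insert j I. [:- z i, 1:]) = [:- z j, 1:] * P"
    unfolding P_def using insert.hyps by (rule prod.insert)
  ultimately show ?case
    using insert.hyps \<open>x - z j \<noteq> 0\<close> by (simp only: prod.insert sum.insert) (simp add: field_simps)
qed simp

section \<open>Bernstein-Walsh growth near a segment\<close>

lemma poly_eq_sum_le:
  fixes p :: "'a :: comm_semiring_1 poly"
  assumes "degree p \<le> n"
  shows "poly p x = (\<Sum>k\<le>n. coeff p k * x ^ k)"
  unfolding poly_altdef[of p x] using assms
  by (intro sum.mono_neutral_left) (auto simp: coeff_eq_0)

text \<open>In the Joukowski coordinate \<open>u = 1/w\<close>, the function \<open>u ^ n * p ((u + 1/u)/2)\<close> is a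
  polynomial that is bounded by \<open>M\<close> on the unit circle.\<close>
lemma bernstein_walsh_joukowski:
  assumes deg: "degree p \<le> n" and M: "\<And>t. -1 \<le> t \<Longrightarrow> t \<le> 1 \<Longrightarrow> cmod (poly p (of_real t)) \<le> M"
    and w: "1 \<le> cmod w"
  shows "cmod (poly p ((w + 1/w)/2)) \<le> cmod w ^ n * M"
proof -
  define Q where "Q u = (\<Sum>k\<le>n. coeff p k * u ^ (n-k) * ((u\<^sup>2+1)/2) ^ k)" for u
  have Q: "Q u = u ^ n * poly p ((u + 1/u)/2)" if "u \<noteq> 0" for u
  proof -
    have "u ^ (n-k) * ((u\<^sup>2+1)/2) ^ k = u ^ n * ((u + 1/u)/2) ^ k" if "k \<le> n" for k
    proof -
      have "(u\<^sup>2+1)/2 = u * ((u + 1/u)/2)" using \<open>u \<noteq> 0\<close> by (simp add: field_simps power2_eq_square)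
      then have "u ^ (n-k) * ((u\<^sup>2+1)/2) ^ k = (u ^ (n-k) * u ^ k) * ((u + 1/u)/2) ^ k"
        by (simp only: power_mult_distrib mult.assoc)
      then show ?thesis using that by (simp flip: power_add)
    qed
    then show ?thesis
      unfolding Q_def poly_eq_sum_le[OF deg] sum_distrib_left
      by (intro sum.cong) (auto simp: mult_ac)
  qed
  define u where "u = 1/w"
  have w0: "w \<noteq> 0" using w by auto
  have "cmod (Q u) \<le> M"
  proof (rule maximum_modulus_frontier[of Q "cball 0 1"])
    show "Q holomorphic_on interior (cball 0 1)" "continuous_on (closure (cball 0 1)) Q"
      unfolding Q_def by (auto intro!: holomorphic_intros continuous_intros)
    show "u \<in> cball 0 1" using w w0 by (simp add: u_def norm_divide divide_simps)
    fix v :: complex assume "v \<in> frontier (cball 0 1)"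
    then have v: "cmod v = 1" by simp
    then have v0: "v \<noteq> 0" by auto
    \<comment> \<open>On the unit circle the Joukowski map takes the real value \<open>Re v\<close>
      in the interval from -1 to 1, where the hypothesis on \<open>p\<close> applies.\<close>
    have "1/v = cnj v" using v v0 by (simp add: field_simps complex_norm_square[symmetric] mult.commute)
    then have "(v + 1/v)/2 = of_real (Re v)" by (simp add: complex_add_cnj)
    moreover have "\<bar>Re v\<bar> \<le> 1" using v abs_Re_le_cmod[of v] by simp
    ultimately show "cmod (Q v) \<le> M"
      using Q[OF v0] M[of "Re v"] v by (auto simp: norm_mult norm_power)
  qed auto
  moreover have "poly p ((w + 1/w)/2) = w ^ n * Q u"
    using Q[of u] w0 by (simp add: u_def field_simps)
  ultimately show ?thesis
    by (simp add: norm_mult norm_power mult_left_mono)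
qed

text \<open>The circles \<open>cmod w = const\<close> correspond to confocal ellipses with foci -1
  and 1. The sum of the focal distances therefore controls \<open>cmod w\<close> directly in terms
  of \<open>t\<close>.\<close>

lemma joukowski_preimage:
  fixes t :: complex
  obtains w where "1 \<le> cmod w" "t = (w + 1/w)/2" "cmod w + 1 / cmod w = cmod (t - 1) + cmod (t + 1)"
proof -
  define w0 where "w0 = t + csqrt (t\<^sup>2 - 1)"
  have *: "w0 * (t - csqrt (t\<^sup>2 - 1)) = 1"
    by (simp add: w0_def algebra_simps flip: power2_eq_square)
  then have w0: "w0 \<noteq> 0" by auto
  then have inv: "1 / w0 = t - csqrt (t\<^sup>2 - 1)" using * by (simp add: field_simps)
  \<comment> \<open>The two solutions are inverse to each other, so one of them lies outside the
    open unit disc.\<close>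
  define w where "w = (if 1 \<le> cmod w0 then w0 else 1 / w0)"
  have w: "1 \<le> cmod w" using w0 by (auto simp: w_def norm_divide)
  then have wn0: "w \<noteq> 0" by auto
  have "w + 1/w = w0 + 1/w0" by (auto simp: w_def)
  also have "\<dots> = 2 * t" unfolding inv by (simp add: w0_def)
  finally have t: "t = (w + 1/w)/2" by simp
  have "t - 1 = (w - 1)\<^sup>2 / (2 * w)" "t + 1 = (w + 1)\<^sup>2 / (2 * w)"
    unfolding t using wn0 by (simp_all add: field_simps power2_eq_square)
  then have "cmod (t - 1) + cmod (t + 1) = ((cmod (w - 1))\<^sup>2 + (cmod (w + 1))\<^sup>2) / (2 * cmod w)"
    by (simp add: norm_divide norm_mult norm_power add_divide_distrib)
  also have "(cmod (w - 1))\<^sup>2 + (cmod (w + 1))\<^sup>2 = 2 * (cmod w)\<^sup>2 + 2"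
    by (simp only: cmod_power2) (simp add: power2_eq_square algebra_simps)
  also have "\<dots> / (2 * cmod w) = cmod w + 1 / cmod w"
    using wn0 by (simp add: field_simps power2_eq_square)
  finally have "cmod w + 1 / cmod w = cmod (t - 1) + cmod (t + 1)" by (rule sym)
  then show ?thesis by (rule that[OF w t])
qed

text \<open>An affine map takes the segment to the interval from -1 to 1, with \<open>a\<close>
  going to -1. The triangle inequality bounds the sum of focal distances by
  \<open>2 * cmod (t + 1) + 2\<close>, and the condition on \<open>x\<close> makes this at most
  \<open>E + 1/E\<close>, the value belonging to \<open>cmod w = E\<close>.\<close>

lemma poly_growth_near_segment:
  assumes deg: "degree p \<le> n" and M: "\<And>y. y \<in> closed_segment a b \<Longrightarrow> cmod (poly p y) \<le> M"
    and ab: "a \<noteq> b" and E: "1 \<le> E" and x: "4 * dist x a \<le> (E + 1/E - 2) * dist a b"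
  shows "cmod (poly p x) \<le> E ^ n * M"
proof -
  define q where "q = pcompose p [:(a + b)/2, (b - a)/2:]"
  have q: "poly q t = poly p (a + (t+1)/2 * (b - a))" for t
  proof -
    have "(a + b)/2 + t * ((b - a)/2) = a + (t+1)/2 * (b - a)" by (simp add: field_simps)
    then show ?thesis by (simp add: q_def poly_pcompose)
  qed
  have degq: "degree q \<le> n" using deg ab by (simp add: q_def degree_pcompose)
  have qM: "cmod (poly q (of_real t)) \<le> M" if "-1 \<le> t" "t \<le> 1" for t
    unfolding q using that
    by (intro M) (auto simp: in_segment scaleR_conv_of_real field_simps intro!: exI[of _ "(t+1)/2"])
  define t where "t = 2 * (x - a) / (b - a) - 1"
  obtain w where w: "1 \<le> cmod w" "t = (w + 1/w)/2" "cmod w + 1 / cmod w = cmod (t - 1) + cmod (t + 1)"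
    by (rule joukowski_preimage)
  have "cmod (t - 1) \<le> cmod (t + 1) + 2"
    using norm_triangle_ineq4[of "t + 1" 2] by (simp add: algebra_simps)
  moreover have "cmod (t + 1) = 2 * dist x a / dist a b"
  proof -
    have "t + 1 = 2 * (x - a) / (b - a)" by (simp add: t_def)
    then show ?thesis
      unfolding dist_norm norm_minus_commute[of a b] by (simp only: norm_divide norm_mult norm_numeral)
  qed
  moreover have "4 * dist x a / dist a b \<le> E + 1/E - 2"
    using x ab by (simp add: pos_divide_le_eq)
  ultimately have "cmod w + 1 / cmod w \<le> E + 1 / E" using w(3) by linarith
  \<comment> \<open>The function \<open>u + 1/u\<close> is increasing for \<open>u >= 1\<close>, as
    the factorisation of the difference of two values shows.\<close>
  have wE: "cmod w \<le> E"
  proof (rule ccontr)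
    assume "\<not> cmod w \<le> E"
    then have less: "E < cmod w" by simp
    have "1 < cmod w * E" using less E w(1) by (metis less_1_mult less_eq_real_def less_le_trans mult.right_neutral)
    then have "0 < (cmod w - E) * (cmod w * E - 1)" using less by simp
    then have "0 < (cmod w - E) * (cmod w * E - 1) / (cmod w * E)"
      using \<open>1 < cmod w * E\<close> by (intro divide_pos_pos) auto
    also have "\<dots> = cmod w + 1 / cmod w - (E + 1/E)"
      using E w(1) by (cases "w = 0") (auto simp: field_simps)
    finally have "E + 1/E < cmod w + 1 / cmod w" by simp
    then show False using \<open>cmod w + 1 / cmod w \<le> E + 1 / E\<close> by simp
  qed
  have "M \<ge> 0" using M[of a] norm_ge_zero order_trans by blast
  have "poly p x = poly q t" 
  proof -
    have "(t + 1) / 2 * (b - a) = x - a" using ab by (simp add: t_def field_simps)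
    then have "a + (t + 1) / 2 * (b - a) = x" by (simp only:) simp
    then show ?thesis unfolding q by (simp only:)
  qed
  then have "cmod (poly p x) \<le> cmod w ^ n * M"
    using bernstein_walsh_joukowski[OF degq qM w(1)] w(2) by simp
  also have "\<dots> \<le> E ^ n * M"
    using wE \<open>M \<ge> 0\<close> by (intro mult_right_mono power_mono) auto
  finally show ?thesis .
qed

text \<open>A Schwarz lemma: the quotient of \<open>p - [:poly p a:]\<close> by the linear factor is
  a polynomial, and the maximum principle carries its bound on the circle into the disc.\<close>

lemma poly_lipschitz_at_centre:
  assumes "\<delta> > 0" and B: "\<And>x. x \<in> cball a \<delta> \<Longrightarrow> cmod (poly p x) \<le> B" and x: "x \<in> cball a \<delta>"
  shows "cmod (poly p x - poly p a) \<le> dist x a * (2 * B / \<delta>)"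
proof -
  have "poly (p - [:poly p a:]) a = 0" by simp
  then have "[:-a, 1:] dvd p - [:poly p a:]" by (rule poly_eq_0_iff_dvd[THEN iffD1])
  then obtain k where "p - [:poly p a:] = [:-a, 1:] * k" by (elim dvdE)
  then have "poly (p - [:poly p a:]) y = poly ([:-a, 1:] * k) y" for y by simp
  then have k: "poly p y - poly p a = (y - a) * poly k y" for y by (simp add: algebra_simps)
  have "cmod (poly k x) \<le> 2 * B / \<delta>"
  proof (rule maximum_modulus_frontier[of "poly k" "cball a \<delta>"])
    fix y assume "y \<in> frontier (cball a \<delta>)"
    then have y: "cmod (y - a) = \<delta>" "y \<in> cball a \<delta>"
      by (auto simp: dist_norm norm_minus_commute)
    have "\<delta> * cmod (poly k y) = cmod (poly p y - poly p a)"
      by (simp add: k norm_mult y)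
    also have "\<dots> \<le> B + B"
      using B[OF y(2)] B[of a] \<open>\<delta> > 0\<close> by (intro norm_triangle_le_diff add_mono) auto
    finally show "cmod (poly k y) \<le> 2 * B / \<delta>" using \<open>\<delta> > 0\<close> by (simp add: field_simps)
  qed (use x in \<open>auto intro!: holomorphic_intros continuous_intros\<close>)
  then have "dist x a * cmod (poly k x) \<le> dist x a * (2 * B / \<delta>)" by (rule mult_left_mono) simp
  then show ?thesis by (simp only: k norm_mult dist_norm)
qed

text \<open>On the disc of radius \<open>\<delta>\<close> about \<open>a\<close> the growth bound is
  \<open>E ^ n * M\<close>; the preceding estimate then loses at most \<open>M / 2\<close> within
  the distance \<open>\<delta> / (4 * E ^ n)\<close>.\<close>

lemma poly_half_max_near_segment_end:
  assumes deg: "degree p \<le> n" and M: "\<And>y. y \<in> closed_segment a b \<Longrightarrow> cmod (poly p y) \<le> M"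
    and ab: "a \<noteq> b" and E: "1 \<le> E" and \<delta>: "\<delta> > 0" "4 * \<delta> \<le> (E + 1/E - 2) * dist a b"
    and pa: "cmod (poly p a) = M" and x: "dist x a \<le> \<delta> / (4 * E ^ n)"
  shows "M / 2 \<le> cmod (poly p x)"
proof -
  have "E ^ n \<ge> 1" using E by simp
  have M0: "M \<ge> 0" using pa by auto
  have B: "cmod (poly p y) \<le> E ^ n * M" if "y \<in> cball a \<delta>" for y
    using that \<delta> by (intro poly_growth_near_segment[OF deg M ab E]) (auto simp: dist_commute)
  have "\<delta> / (4 * E ^ n) \<le> \<delta> / 1" using \<delta> \<open>E ^ n \<ge> 1\<close> by (intro divide_left_mono) auto
  then have "x \<in> cball a \<delta>" using x by (simp add: dist_commute)
  then have "cmod (poly p x - poly p a) \<le> dist x a * (2 * (E ^ n * M) / \<delta>)"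
    using B by (intro poly_lipschitz_at_centre[OF \<delta>(1)])
  also have "\<dots> \<le> \<delta> / (4 * E ^ n) * (2 * (E ^ n * M) / \<delta>)"
    using x \<delta> M0 E by (intro mult_right_mono) auto
  also have "\<dots> = M / 2" using \<delta> \<open>E ^ n \<ge> 1\<close> E by (simp add: field_simps)
  finally show ?thesis using pa norm_triangle_ineq2[of "poly p a" "poly p x"]
    by (simp add: norm_minus_commute)
qed

section \<open>The dichotomy at a single boundary point\<close>

text \<open>With the boundary point at the origin, \<open>v\<close> is a zero and \<open>y\<close> a
  point of the disc. By the law of cosines the squared distance of a nearly tangential
  \<open>v\<close> to the centre exceeds its squared distance to the origin by at least
  \<open>h^2 / 2\<close>. As \<open>cmod v <= d\<close>, this leaves room for the factor
  \<open>s^2\<close> and the radius \<open>\<rho>\<close>.\<close>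

lemma dist_ge_of_nearly_tangential:
  fixes v \<nu> y0 y :: complex
  assumes \<nu>: "cmod \<nu> = 1" and v: "cmod v \<le> d" and d: "0 < d" and h: "0 < h" "h \<le> d"
    and tan: "Re (v * cnj \<nu>) \<le> h / (4 * d) * cmod v"
    and \<rho>: "0 \<le> \<rho>" "\<rho> \<le> d" "20 * d * \<rho> \<le> h\<^sup>2"
    and s: "1 \<le> s" "s\<^sup>2 = 1 + h\<^sup>2 / (12 * d\<^sup>2)" and y: "dist y (of_real h * \<nu>) \<le> \<rho>"
  shows "s\<^sup>2 * cmod v \<le> cmod (y - v)"
proof -
  define r where "r = cmod v"
  define \<kappa> where "\<kappa> = h\<^sup>2 / (12 * d\<^sup>2)"
  have r: "0 \<le> r" "r \<le> d" using v by (auto simp: r_def)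
  have \<kappa>: "0 \<le> \<kappa>" "12 * d\<^sup>2 * \<kappa> = h\<^sup>2" using d by (auto simp: \<kappa>_def)
  have "h\<^sup>2 \<le> d\<^sup>2" using h by (intro power_mono) auto
  then have \<kappa>1: "\<kappa> \<le> 1" using d by (simp add: \<kappa>_def divide_simps) (use zero_le_power2[of d] in linarith)
  have "(cmod (of_real h * \<nu> - v))\<^sup>2 = h\<^sup>2 + r\<^sup>2 - 2 * h * Re (v * cnj \<nu>)"
  proof -
    have "(Re \<nu>)\<^sup>2 + (Im \<nu>)\<^sup>2 = 1" using \<nu> by (simp flip: cmod_power2)
    then have "h\<^sup>2 * ((Re \<nu>)\<^sup>2 + (Im \<nu>)\<^sup>2) = h\<^sup>2" by simp
    then show ?thesis
      unfolding r_def by (simp only: cmod_power2) (simp add: power2_eq_square algebra_simps)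
  qed
  moreover have "2 * h * Re (v * cnj \<nu>) \<le> 2 * h * (h / (4 * d) * r)"
    using tan h by (intro mult_left_mono) (auto simp: r_def)
  moreover have "2 * h * (h / (4 * d) * r) \<le> h\<^sup>2 / 2"
    using d r h by (simp add: field_simps power2_eq_square mult_left_mono)
  ultimately have *: "r\<^sup>2 + h\<^sup>2 / 2 \<le> (cmod (of_real h * \<nu> - v))\<^sup>2" by linarith
  \<comment> \<open>The gain \<open>h^2 / 2\<close> is shared equally: the constants 12 in
    \<open>\<kappa>\<close> and 20 in the bound on \<open>\<rho>\<close> make each of the two error
    terms at most \<open>h^2 / 4\<close>.\<close>
  have "((1 + \<kappa>) * r + \<rho>)\<^sup>2 = r\<^sup>2 + (2 * \<kappa> + \<kappa>\<^sup>2) * r\<^sup>2 + (2 * (1 + \<kappa>) * r * \<rho> + \<rho>\<^sup>2)"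
    by (simp add: power2_eq_square algebra_simps)
  also have "(2 * \<kappa> + \<kappa>\<^sup>2) * r\<^sup>2 \<le> (3 * \<kappa>) * d\<^sup>2"
  proof (rule mult_mono)
    show "2 * \<kappa> + \<kappa>\<^sup>2 \<le> 3 * \<kappa>"
      using mult_left_mono[OF \<kappa>1 \<kappa>(1)] by (simp add: power2_eq_square)
  qed (use r \<kappa> in \<open>auto intro: power_mono\<close>)
  also have "2 * (1 + \<kappa>) * r * \<rho> + \<rho>\<^sup>2 \<le> 5 * d * \<rho>"
  proof -
    have "(2 * (1 + \<kappa>)) * r \<le> 4 * d" using r \<kappa> \<kappa>1 by (intro mult_mono) auto
    then have "(2 * (1 + \<kappa>)) * r * \<rho> \<le> 4 * d * \<rho>" using \<rho> by (intro mult_right_mono) auto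
    moreover have "\<rho>\<^sup>2 \<le> d * \<rho>" using \<rho> by (simp add: power2_eq_square mult_right_mono)
    ultimately show ?thesis by simp
  qed
  also have "r\<^sup>2 + 3 * \<kappa> * d\<^sup>2 + 5 * d * \<rho> \<le> r\<^sup>2 + h\<^sup>2 / 2"
    using \<kappa>(2) \<rho>(3) by (simp add: algebra_simps)
  also note *
  finally have "(1 + \<kappa>) * r + \<rho> \<le> cmod (of_real h * \<nu> - v)"
    by (rule power2_le_imp_le) auto
  moreover have "cmod (of_real h * \<nu> - v) \<le> \<rho> + cmod (y - v)"
    using y norm_triangle_ineq[of "of_real h * \<nu> - y" "y - v"] by (simp add: dist_norm norm_minus_commute)
  ultimately show ?thesis by (simp add: s(2) \<kappa>_def r_def)
qed

text \<open>Either a fixed fraction of the zeros is seen from \<open>\<zeta>\<close> at an angle bounded away from the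
  supporting line, and then they alone make the logarithmic derivative large, or almost all zeros are
  nearly tangential, and \<open>p\<close> grows exponentially on the way from \<open>\<zeta>\<close> to the disc.\<close>
lemma log_deriv_ge_or_growth:
  fixes p :: "complex poly"
  assumes zeros: "\<And>z. poly p z = 0 \<Longrightarrow> z \<in> K"
    and \<nu>: "cmod \<nu> = 1" and supp: "\<And>w. w \<in> K \<Longrightarrow> 0 \<le> Re ((w - \<zeta>) * cnj \<nu>)"
    and disc: "cball (\<zeta> + of_real h * \<nu>) \<rho> \<subseteq> K"
    and d: "0 < d" "\<And>w. w \<in> K \<Longrightarrow> dist w \<zeta> \<le> d" and h: "0 < h" "h \<le> d"
    and \<rho>: "0 < \<rho>" "\<rho> \<le> d" "20 * d * \<rho> \<le> h\<^sup>2"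
    and s: "1 \<le> s" "s\<^sup>2 = 1 + h\<^sup>2 / (12 * d\<^sup>2)" and N: "0 < N" "d * s\<^sup>2 / \<rho> \<le> s ^ N"
  shows "h / (4 * d\<^sup>2 * real N) * real (degree p) * cmod (poly p \<zeta>) \<le> cmod (poly (pderiv p) \<zeta>) \<or>
    (\<exists>y\<in>K. s ^ degree p * cmod (poly p \<zeta>) \<le> cmod (poly p y))"
proof (cases "poly p \<zeta> = 0")
  case nz: False
  define n where "n = degree p"
  obtain z where z: "smult (lead_coeff p) (\<Prod>i<n. [:- z i, 1:]) = p"
    using complex_poly_decompose'[of p] unfolding n_def by blast
  define a where "a = lead_coeff p"
  have p: "poly p x = a * (\<Prod>i<n. x - z i)" for x
    by (subst z[symmetric]) (simp add: poly_prod a_def)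
  have zK: "z i \<in> K" if "i < n" for i
    using that by (intro zeros) (auto simp: p)
  have z\<zeta>: "\<zeta> \<noteq> z i" if "i < n" for i using nz that by (auto simp: p)
  define r where "r i = cmod (z i - \<zeta>)" for i
  define t where "t i = Re ((z i - \<zeta>) * cnj \<nu>)" for i
  have r: "0 < r i" "r i \<le> d" if "i < n" for i
    using z\<zeta>[OF that] d(2)[OF zK[OF that]] by (auto simp: r_def dist_norm)
  \<comment> \<open>\<open>G\<close> collects the nearly tangential zeros and \<open>B\<close> the
    others, which make a guaranteed contribution to the logarithmic derivative.\<close>
  define G where "G = {i. i < n \<and> t i \<le> h / (4 * d) * r i}"
  define B where "B = {i. i < n \<and> \<not> t i \<le> h / (4 * d) * r i}"
  have GB: "finite G" "finite B" "{..<n} = G \<union> B" "G \<inter> B = {}" by (auto simp: G_def B_def)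
  have cardGB: "n = card G + card B" using card_Un_disjoint[OF GB(1,2,4)] GB(3) by (metis card_lessThan)
  have pder: "poly (pderiv p) \<zeta> = poly p \<zeta> * (\<Sum>i<n. 1 / (\<zeta> - z i))"
    using poly_pderiv_prod_linear[of "{..<n}" \<zeta> z] z\<zeta>
    by (subst z[symmetric]) (simp add: pderiv_smult p a_def)
  \<comment> \<open>After multiplication by \<open>\<nu>\<close>, the term of \<open>z i\<close> has
    real part \<open>- t i / (r i)^2\<close>, where \<open>t i >= 0\<close> by the supporting
    half-plane. So nothing cancels, and each zero in \<open>B\<close> contributes at least
    \<open>h / (4 * d^2)\<close>.\<close>
  have "real (card B) * (h / (4 * d\<^sup>2)) \<le> (\<Sum>i\<in>B. t i / (r i)\<^sup>2)"
  proof -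
    have "h / (4 * d\<^sup>2) \<le> t i / (r i)\<^sup>2" if "i \<in> B" for i
    proof -
      have i: "i < n" "h / (4 * d) * r i < t i" using that by (auto simp: B_def)
      have "h / (4 * d\<^sup>2) = (h / (4 * d)) / d" by (simp add: power2_eq_square)
      also have "\<dots> \<le> (h / (4 * d)) / r i"
        using r[OF i(1)] h d by (intro divide_left_mono) auto
      also have "\<dots> = (h / (4 * d)) * r i / (r i)\<^sup>2" using r[OF i(1)] by (simp add: power2_eq_square)
      also have "\<dots> \<le> t i / (r i)\<^sup>2" using i(2) by (intro divide_right_mono) auto
      finally show ?thesis .
    qed
    then show ?thesis by (rule sum_bounded_below)
  qed
  also have "\<dots> \<le> (\<Sum>i<n. t i / (r i)\<^sup>2)"
    using supp[OF zK] GB by (intro sum_mono2) (auto simp: t_def B_def G_def)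
  also have "\<dots> = - Re (\<nu> * (\<Sum>i<n. 1 / (\<zeta> - z i)))"
  proof -
    have "t i / (r i)\<^sup>2 = - Re (\<nu> * (1 / (\<zeta> - z i)))" for i
      by (simp add: t_def r_def cmod_power2 Re_divide algebra_simps flip: add_divide_distrib minus_divide_left)
         (simp add: power2_eq_square algebra_simps diff_divide_distrib add_divide_distrib)
    then show ?thesis by (simp add: sum_distrib_left Re_sum sum_negf)
  qed
  also have "\<dots> \<le> cmod (\<Sum>i<n. 1 / (\<zeta> - z i))"
    using abs_Re_le_cmod[of "\<nu> * (\<Sum>i<n. 1 / (\<zeta> - z i))"] \<nu> by (simp add: norm_mult)
  finally have der: "real (card B) * (h / (4 * d\<^sup>2)) \<le> cmod (\<Sum>i<n. 1 / (\<zeta> - z i))" .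
  show ?thesis
  proof (cases "n \<le> N * card B")
    case True
    have "h / (4 * d\<^sup>2 * real N) * real n \<le> h / (4 * d\<^sup>2 * real N) * real (N * card B)"
      using True h by (intro mult_left_mono) (auto simp del: of_nat_mult)
    also have "\<dots> = real (card B) * (h / (4 * d\<^sup>2))" using N(1) by simp
    also note der
    finally have "h / (4 * d\<^sup>2 * real N) * real n * cmod (poly p \<zeta>)
        \<le> cmod (\<Sum>i<n. 1 / (\<zeta> - z i)) * cmod (poly p \<zeta>)"
      by (rule mult_right_mono) simp
    then show ?thesis by (simp only: n_def pder norm_mult mult.commute[of "cmod (poly p \<zeta>)"] simp_thms)
  next
    case False
    \<comment> \<open>A single \<open>y\<close> handles the zeros of \<open>B\<close> jointly,
      through their product; those of \<open>G\<close> recede individually at every point of the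
      disc.\<close>
    obtain y where y: "y \<in> cball (\<zeta> + of_real h * \<nu>) \<rho>" "\<rho> ^ card B \<le> (\<Prod>i\<in>B. cmod (y - z i))"
      using exists_prod_dist_ge[OF GB(2) \<rho>(1)] by blast
    have good: "s\<^sup>2 * r i \<le> cmod (y - z i)" if "i \<in> G" for i
    proof -
      have i: "i < n" "t i \<le> h / (4 * d) * r i" using that by (auto simp: G_def)
      have "s\<^sup>2 * cmod (z i - \<zeta>) \<le> cmod ((y - \<zeta>) - (z i - \<zeta>))"
        using i r[OF i(1)] y(1) \<rho>
        by (intro dist_ge_of_nearly_tangential[OF \<nu> _ d(1) h _ _ \<rho>(2,3) s])
           (auto simp: r_def t_def dist_norm norm_minus_commute algebra_simps)
      then show ?thesis by (simp add: r_def)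
    qed
    define m where "m = card B"
    \<comment> \<open>Relative to a gain of \<open>s^2\<close> for all \<open>n\<close> zeros, each
      zero of \<open>B\<close> costs at most a factor \<open>d * s^2 / \<rho>\<close>. Since
      \<open>N * m < n\<close>, the choice of \<open>N\<close> bounds the total cost by
      \<open>s ^ n\<close>, and a gain of \<open>s ^ n\<close> survives.\<close>
    have "(d * s\<^sup>2 / \<rho>) ^ m \<le> (s ^ N) ^ m"
      using N d \<rho> by (intro power_mono) auto
    also have "\<dots> \<le> s ^ n" using s(1) False unfolding m_def power_mult[symmetric]
      by (intro power_increasing) auto
    finally have "(d * s\<^sup>2) ^ m \<le> s ^ n * \<rho> ^ m" using \<rho>(1) by (simp add: power_divide pos_divide_le_eq)
    then have "s ^ n * (d * s\<^sup>2) ^ m \<le> s ^ n * (s ^ n * \<rho> ^ m)" using s by (intro mult_left_mono) auto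
    also have "\<dots> = (s\<^sup>2) ^ m * ((s\<^sup>2) ^ card G * \<rho> ^ m)"
      using cardGB by (simp add: m_def power_add power_mult_distrib power2_eq_square algebra_simps)
    finally have "(s\<^sup>2) ^ m * (s ^ n * d ^ m) \<le> (s\<^sup>2) ^ m * ((s\<^sup>2) ^ card G * \<rho> ^ m)"
      by (simp add: power_mult_distrib algebra_simps)
    then have key: "s ^ n * d ^ m \<le> (s\<^sup>2) ^ card G * \<rho> ^ m"
      by (rule mult_left_le_imp_le) (use s(1) in simp)
    have dvi: "cmod (\<zeta> - z i) = r i" for i by (simp add: r_def norm_minus_commute)
    have "s ^ n * (\<Prod>i<n. cmod (\<zeta> - z i)) = s ^ n * ((\<Prod>i\<in>G. r i) * (\<Prod>i\<in>B. r i))"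
      by (simp only: dvi GB(3) prod.union_disjoint[OF GB(1,2,4)])
    also have "\<dots> \<le> s ^ n * ((\<Prod>i\<in>G. r i) * d ^ m)"
      using s r unfolding m_def
      by (intro mult_left_mono prod_nonneg order_trans[OF prod_mono[of B r "\<lambda>_. d"]])
         (auto simp: B_def G_def intro: less_imp_le)
    also have "\<dots> \<le> (\<Prod>i\<in>G. r i) * ((s\<^sup>2) ^ card G * \<rho> ^ m)"
    proof -
      have "0 \<le> (\<Prod>i\<in>G. r i)" using r(1) by (intro prod_nonneg) (auto simp: G_def intro: less_imp_le)
      from mult_left_mono[OF key this] show ?thesis by (simp only: mult_ac)
    qed
    also have "\<dots> = (\<Prod>i\<in>G. s\<^sup>2 * r i) * \<rho> ^ m" by (simp add: prod.distrib)
    also have "\<dots> \<le> (\<Prod>i\<in>G. cmod (y - z i)) * (\<Prod>i\<in>B. cmod (y - z i))"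
      using good y(2) r \<rho> unfolding m_def
      by (intro mult_mono prod_mono prod_nonneg)
         (auto simp: G_def intro!: mult_nonneg_nonneg intro: less_imp_le)
    also have "\<dots> = (\<Prod>i<n. cmod (y - z i))"
      by (simp only: GB(3) prod.union_disjoint[OF GB(1,2,4)])
    finally have "cmod a * (s ^ n * (\<Prod>i<n. cmod (\<zeta> - z i))) \<le> cmod a * (\<Prod>i<n. cmod (y - z i))"
      by (rule mult_left_mono) simp
    then have "s ^ n * cmod (poly p \<zeta>) \<le> cmod (poly p y)"
      by (simp add: p norm_mult prod_norm mult_ac)
    then show ?thesis using disc y(1) unfolding n_def by blast
  qed
qed simp

section \<open>Smooth convex domains\<close>

text \<open>For \<open>\<zeta>\<close> in \<open>K\<close> these are the unit vectors of the normal
  cone with the sign reversed; \<open>Re (z * cnj \<nu>)\<close> is the real inner product.\<close>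

definition inward_normal :: "complex set \<Rightarrow> complex \<Rightarrow> complex \<Rightarrow> bool" where
  "inward_normal K \<zeta> \<nu> \<longleftrightarrow> cmod \<nu> = 1 \<and> (\<forall>w\<in>K. 0 \<le> Re ((w - \<zeta>) * cnj \<nu>))"

lemma inward_normalD:
  assumes "inward_normal K \<zeta> \<nu>"
  shows "cmod \<nu> = 1" "\<And>w. w \<in> K \<Longrightarrow> 0 \<le> Re ((w - \<zeta>) * cnj \<nu>)" "\<nu> * cnj \<nu> = 1"
  using assms unfolding inward_normal_def by (auto simp flip: complex_norm_square)

lemma supporting_line_inward_normal:
  assumes "inward_normal K \<zeta> \<nu>"
  shows "supporting_line K \<zeta> {w. Re ((w - \<zeta>) * cnj \<nu>) = 0}"
  unfolding supporting_line_def
proof (intro conjI exI[of _ "-\<nu>"] exI[of _ "Re (\<zeta> * cnj (-\<nu>))"])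
  show "-\<nu> \<noteq> 0" using inward_normalD(1)[OF assms] by auto
qed (use inward_normalD(2)[OF assms] in \<open>auto simp: algebra_simps\<close>)

lemma smooth_convex_inward_normal:
  assumes "smooth_convex K" "\<zeta> \<in> frontier K"
  obtains \<nu> where "inward_normal K \<zeta> \<nu>"
proof -
  obtain L where "supporting_line K \<zeta> L"
    using assms unfolding smooth_convex_def by blast
  then obtain n c where n: "n \<noteq> 0" "Re (\<zeta> * cnj n) = c" "\<And>w. w \<in> K \<Longrightarrow> Re (w * cnj n) \<le> c"
    unfolding supporting_line_def by blast
  have "inward_normal K \<zeta> (- n / of_real (cmod n))"
    unfolding inward_normal_def
  proof (intro conjI ballI)
    show "cmod (- n / of_real (cmod n)) = 1" using n(1) by (simp add: norm_divide)
    fix w assume "w \<in> K"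
    have "Re ((w - \<zeta>) * cnj (- n / of_real (cmod n))) = (c - Re (w * cnj n)) / cmod n"
      using n(1) unfolding n(2)[symmetric] by (simp add: field_simps)
    then show "0 \<le> Re ((w - \<zeta>) * cnj (- n / of_real (cmod n)))"
      using n(3)[OF \<open>w \<in> K\<close>] by simp
  qed
  then show ?thesis by (rule that)
qed

text \<open>Two opposite normals would confine \<open>K\<close> to a line, against the nonempty
  interior.\<close>

lemma inward_normal_not_opposite:
  assumes "interior K \<noteq> {}" "inward_normal K \<zeta> \<nu>"
  shows "\<not> inward_normal K \<zeta> (-\<nu>)"
proof
  assume opp: "inward_normal K \<zeta> (-\<nu>)"
  obtain x e where e: "e > 0" "cball x e \<subseteq> K" using assms(1) mem_interior_cball by blast
  have "x \<in> K" "x + of_real e * \<nu> \<in> K"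
    using e inward_normalD(1)[OF assms(2)] by (auto simp: dist_norm norm_mult intro!: subsetD[OF e(2)])
  moreover have "Re ((w - \<zeta>) * cnj \<nu>) = 0" if "w \<in> K" for w
    using inward_normalD(2)[OF assms(2) that] inward_normalD(2)[OF opp that] by simp
  ultimately have "Re ((x - \<zeta>) * cnj \<nu>) = 0" "Re ((x + of_real e * \<nu> - \<zeta>) * cnj \<nu>) = 0" by blast+
  moreover have "(x + of_real e * \<nu> - \<zeta>) * cnj \<nu> = (x - \<zeta>) * cnj \<nu> + of_real e"
    using inward_normalD(3)[OF assms(2)] by (simp add: algebra_simps)
  ultimately show False using e(1) by simp
qed

text \<open>Both normals belong to the unique supporting line, hence agree up to sign, and the
  opposite sign is excluded.\<close>

lemma smooth_convex_normals_angle: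
  assumes "smooth_convex K" "interior K \<noteq> {}" "\<zeta> \<in> frontier K"
    "inward_normal K \<zeta> \<nu>" "inward_normal K \<zeta> \<mu>"
  shows "0 < Re (\<nu> * cnj \<mu>)"
proof (rule ccontr)
  assume "\<not> 0 < Re (\<nu> * cnj \<mu>)"
  have "{w. Re ((w - \<zeta>) * cnj \<nu>) = 0} = {w. Re ((w - \<zeta>) * cnj \<mu>) = 0}"
    using assms(1,3) supporting_line_inward_normal[OF assms(4)] supporting_line_inward_normal[OF assms(5)]
    unfolding smooth_convex_def by blast
  \<comment> \<open>The tangential point \<open>\<zeta> + \<i> * \<nu>\<close> tests the equality of
    the two lines; it forces \<open>\<nu> * cnj \<mu>\<close> to be real.\<close>
  moreover have "Re ((\<zeta> + \<i> * \<nu> - \<zeta>) * cnj \<nu>) = 0"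
    using inward_normalD(3)[OF assms(4)] by (simp add: mult.assoc)
  ultimately have "Re ((\<zeta> + \<i> * \<nu> - \<zeta>) * cnj \<mu>) = 0" by blast
  then have "Im (\<nu> * cnj \<mu>) = 0" by (simp add: algebra_simps)
  moreover have "cmod (\<nu> * cnj \<mu>) = 1"
    using inward_normalD(1)[OF assms(4)] inward_normalD(1)[OF assms(5)] by (simp add: norm_mult)
  ultimately have "\<nu> * cnj \<mu> = -1"
    using \<open>\<not> 0 < Re (\<nu> * cnj \<mu>)\<close> by (auto simp: complex_eq_iff cmod_def)
  then have "(\<nu> * cnj \<mu>) * \<mu> = -\<mu>" by simp
  moreover have "(\<nu> * cnj \<mu>) * \<mu> = \<nu> * (\<mu> * cnj \<mu>)" by (simp only: mult_ac)
  ultimately have "\<mu> = -\<nu>" using inward_normalD(3)[OF assms(5)] by simp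
  then show False using inward_normal_not_opposite[OF assms(2,4)] assms(5) by simp
qed

lemma inner_complex_eq_Re: "inner a x = Re (x * cnj a)"
  by (simp add: inner_complex_def algebra_simps)

text \<open>Otherwise a line separating the normal ray from the interior would be a second supporting line.\<close>
lemma smooth_convex_normal_ray_interior:
  assumes K: "convex_domain K" and sm: "smooth_convex K" and \<zeta>: "\<zeta> \<in> frontier K"
    and \<nu>: "inward_normal K \<zeta> \<nu>"
  shows "\<exists>t>0. \<zeta> + of_real t * \<nu> \<in> interior K"
proof (rule ccontr)
  assume none: "\<not> ?thesis"
  have Kc: "compact K" "convex K" "interior K \<noteq> {}" using K by (auto simp: convex_domain_def)
  define S where "S = (\<lambda>t. \<zeta> + of_real t * \<nu>) ` {0<..}"
  have "S = (+) \<zeta> ` (\<lambda>t. t *\<^sub>R \<nu>) ` {0<..}" by (auto simp: S_def scaleR_conv_of_real image_image)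
  then have "convex S"
    by (auto intro!: convex_translation convex_linear_image bounded_linear.linear bounded_linear_intros)
  moreover have "S \<inter> interior K = {}" using none by (auto simp: S_def)
  moreover have "S \<noteq> {}" by (auto simp: S_def)
  ultimately obtain a b where a: "a \<noteq> 0" "\<And>x. x \<in> S \<Longrightarrow> inner a x \<le> b" "\<And>x. x \<in> interior K \<Longrightarrow> b \<le> inner a x"
    using separating_hyperplane_sets[OF _ convex_interior[OF Kc(2)]] Kc(3) by metis
  \<comment> \<open>The separation concerns the interior only, but \<open>K\<close> lies in its
    closure.\<close>
  have "K \<subseteq> {x. b \<le> inner a x}"
  proof -
    have "closure (interior K) \<subseteq> {x. b \<le> inner a x}"
      using a(3) by (intro closure_minimal) (auto simp: closed_halfspace_ge)
    then show ?thesis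
      using convex_closure_interior[OF Kc(2,3)] closure_subset by blast
  qed
  then have bK: "b \<le> inner a x" if "x \<in> K" for x using that by blast
  have ray: "inner a \<zeta> + t * inner a \<nu> \<le> b" if "t > 0" for t
    using a(2)[of "\<zeta> + of_real t * \<nu>"] that by (auto simp: S_def inner_add_right simp flip: scaleR_conv_of_real)
  have "\<zeta> \<in> K" using \<zeta> Kc(1) by (metis compact_imp_closed frontier_subset_closed subsetD)
  \<comment> \<open>The ray at \<open>t = 1\<close> gives \<open>inner a \<nu> <= 0\<close>; as
    \<open>t\<close> tends to 0 it shows that the separating line passes through
    \<open>\<zeta>\<close>. So the normalised \<open>a\<close> is an inward normal not at an acute
    angle to \<open>\<nu>\<close>.\<close>
  have a\<nu>: "inner a \<nu> \<le> 0" using ray[of 1] bK[OF \<open>\<zeta> \<in> K\<close>] by simp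
  have "((\<lambda>t. inner a \<zeta> + t * inner a \<nu>) \<longlongrightarrow> inner a \<zeta> + 0 * inner a \<nu>) (at_right 0)"
    by (intro tendsto_intros)
  then have "inner a \<zeta> + 0 * inner a \<nu> \<le> b"
    by (rule tendsto_upperbound) (auto simp: eventually_at_right_field intro!: exI[of _ 1] ray)
  then have ab: "inner a \<zeta> \<le> b" by simp
  define \<mu> where "\<mu> = a / of_real (cmod a)"
  have in\<mu>: "Re (x * cnj \<mu>) = inner a x / cmod a" for x
    by (simp add: \<mu>_def inner_complex_eq_Re)
  have "inward_normal K \<zeta> \<mu>"
    unfolding inward_normal_def
  proof (intro conjI ballI)
    show "cmod \<mu> = 1" using a(1) by (simp add: \<mu>_def norm_divide)
    fix w assume "w \<in> K"
    then show "0 \<le> Re ((w - \<zeta>) * cnj \<mu>)"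
      unfolding in\<mu> using bK[of w] ab by (simp add: inner_diff_right)
  qed
  then have "0 < Re (\<nu> * cnj \<mu>)"
    by (rule smooth_convex_normals_angle[OF sm Kc(3) \<zeta> \<nu>])
  then show False unfolding in\<mu> using a\<nu> a(1) by (simp add: zero_less_divide_iff)
qed

text \<open>Closedness of the set of pairs of point and normal, for the compactness argument that
  follows.\<close>

lemma inward_normal_limit:
  assumes "\<And>k. inward_normal K (z k) (v k)" "z \<longlonglongrightarrow> \<zeta>" "v \<longlonglongrightarrow> \<nu>"
  shows "inward_normal K \<zeta> \<nu>"
  unfolding inward_normal_def
proof (intro conjI ballI)
  have "(\<lambda>k. cmod (v k)) \<longlonglongrightarrow> cmod \<nu>" by (intro tendsto_intros assms)
  then show "cmod \<nu> = 1"
    using inward_normalD(1)[OF assms(1)] by (simp add: LIMSEQ_const_iff)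
  fix w assume "w \<in> K"
  have "(\<lambda>k. Re ((w - z k) * cnj (v k))) \<longlonglongrightarrow> Re ((w - \<zeta>) * cnj \<nu>)"
    by (intro tendsto_intros assms)
  then show "0 \<le> Re ((w - \<zeta>) * cnj \<nu>)"
    by (rule LIMSEQ_le_const) (use inward_normalD(2)[OF assms(1) \<open>w \<in> K\<close>] in auto)
qed

text \<open>If no pair works, choose counterexamples with \<open>h = 1/j\<close> and
  \<open>\<rho> = 1/j^2\<close> and pass to a limit point. There some disc about a point of the
  normal lies in \<open>K\<close>; for nearby boundary points, convexity lets one shrink it towards
  the boundary point to height \<open>1/j\<close>. Its radius then decreases only like
  \<open>1/j\<close>, which beats \<open>1/j^2\<close>.\<close>

lemma smooth_convex_uniform_disc:
  assumes K: "convex_domain K" and sm: "smooth_convex K"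
  shows "\<exists>h>0. \<exists>\<rho>>0. \<forall>\<zeta>\<in>frontier K. \<forall>\<nu>. inward_normal K \<zeta> \<nu> \<longrightarrow>
    cball (\<zeta> + of_real h * \<nu>) \<rho> \<subseteq> K"
proof (rule ccontr)
  assume none: "\<not> ?thesis"
  have Kc: "compact K" "convex K" "interior K \<noteq> {}" using K by (auto simp: convex_domain_def)
  have frK: "frontier K \<subseteq> K" using Kc(1) by (simp add: compact_imp_closed frontier_subset_closed)
  have "\<exists>\<zeta> \<nu>. \<zeta> \<in> frontier K \<and> inward_normal K \<zeta> \<nu> \<and>
      \<not> cball (\<zeta> + of_real (1 / real (Suc k)) * \<nu>) (1 / (real (Suc k))\<^sup>2) \<subseteq> K" for k
    using none by (metis of_nat_0_less_iff zero_less_Suc zero_less_divide_1_iff zero_less_power)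
  then obtain z v where zv: "\<And>k. z k \<in> frontier K" "\<And>k. inward_normal K (z k) (v k)"
    "\<And>k. \<not> cball (z k + of_real (1 / real (Suc k)) * v k) (1 / (real (Suc k))\<^sup>2) \<subseteq> K"
    by metis
  define S where "S = frontier K \<times> (sphere 0 1 :: complex set)"
  have "compact S" unfolding S_def
    using Kc(1) by (intro compact_Times compact_frontier) auto
  moreover have "\<forall>k. (z k, v k) \<in> S"
    using zv(1) inward_normalD(1)[OF zv(2)] by (auto simp: S_def)
  ultimately have "\<exists>l\<in>S. \<exists>r. strict_mono (r :: nat \<Rightarrow> nat) \<and> ((\<lambda>k. (z k, v k)) \<circ> r) \<longlonglongrightarrow> l"
    unfolding compact_def by (elim allE[of _ "\<lambda>k. (z k, v k)"]) (rule mp)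
  then obtain l r where l: "l \<in> S" "strict_mono (r :: nat \<Rightarrow> nat)"
    "((\<lambda>k. (z k, v k)) \<circ> r) \<longlonglongrightarrow> l" by blast
  define \<zeta> where "\<zeta> = fst l"
  define \<nu> where "\<nu> = snd l"
  have lim: "(\<lambda>k. z (r k)) \<longlonglongrightarrow> \<zeta>" "(\<lambda>k. v (r k)) \<longlonglongrightarrow> \<nu>"
    using tendsto_fst[OF l(3)] tendsto_snd[OF l(3)] by (simp_all add: o_def \<zeta>_def \<nu>_def)
  have "inward_normal K \<zeta> \<nu>" by (rule inward_normal_limit[OF zv(2) lim])
  moreover have "\<zeta> \<in> frontier K" using l(1) by (auto simp: \<zeta>_def S_def)
  ultimately obtain t where t: "t > 0" "\<zeta> + of_real t * \<nu> \<in> interior K"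
    using smooth_convex_normal_ray_interior[OF K sm] by blast
  then obtain e0 where e0: "e0 > 0" "cball (\<zeta> + of_real t * \<nu>) e0 \<subseteq> K"
    using mem_interior_cball by blast
  define e where "e = e0 / 2"
  have "(\<lambda>k. z (r k) + of_real t * v (r k)) \<longlonglongrightarrow> \<zeta> + of_real t * \<nu>"
    by (intro tendsto_intros lim)
  then have "\<forall>\<^sub>F k in sequentially. dist (z (r k) + of_real t * v (r k)) (\<zeta> + of_real t * \<nu>) < e"
    by (rule tendstoD) (use e0 in \<open>simp add: e_def\<close>)
  \<comment> \<open>The summand \<open>1 / t\<close> keeps the ratio \<open>1 / (j * t)\<close> of
    the homothety at most 1, and \<open>t / e\<close> makes the shrunken radius at least
    \<open>1/j^2\<close>. The other half of \<open>e0\<close> absorbs the shift of the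
    centre.\<close>
  moreover have "\<forall>\<^sub>F k in sequentially. 1 / t + t / e \<le> real k"
    using filterlim_real_sequentially by (simp add: filterlim_at_top)
  ultimately have "\<forall>\<^sub>F k in sequentially. False"
  proof eventually_elim
    case (elim k)
    define j where "j = real (Suc (r k))"
    have "k \<le> r k" using l(2) by (rule seq_suble)
    then have j: "1 / t + t / e \<le> j" "0 < j" using elim(2) by (auto simp: j_def)
    have e: "e > 0" using e0 by (simp add: e_def)
    have j1: "1 / t \<le> j" and j2: "t / e \<le> j"
      using j(1) divide_pos_pos[OF t(1) e] t(1) by (smt (verit) zero_less_divide_1_iff)+
    have "cball (z (r k) + of_real (1 / j) * v (r k)) (1 / j\<^sup>2) \<subseteq> K"
    proof
      fix y assume y: "y \<in> cball (z (r k) + of_real (1 / j) * v (r k)) (1 / j\<^sup>2)"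
      define x where "x = z (r k) + of_real (j * t) * (y - z (r k))"
      have "x - (z (r k) + of_real t * v (r k)) = of_real (j * t) * (y - (z (r k) + of_real (1 / j) * v (r k)))"
        using j(2) by (simp add: x_def field_simps)
      then have "dist x (z (r k) + of_real t * v (r k)) = (j * t) * dist y (z (r k) + of_real (1 / j) * v (r k))"
        using j(2) t(1) by (simp add: dist_norm norm_mult)
      also have "\<dots> \<le> (j * t) * (1 / j\<^sup>2)"
        using y j(2) t(1) by (intro mult_left_mono) (auto simp: dist_commute)
      also have "\<dots> = t / j" using j(2) by (simp add: power2_eq_square)
      also have "\<dots> \<le> e" using j(2) j2 e by (simp add: field_simps)
      finally have "dist x (\<zeta> + of_real t * \<nu>) \<le> e0"
        using elim(1) dist_triangle[of x "\<zeta> + of_real t * \<nu>" "z (r k) + of_real t * v (r k)"]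
        by (simp add: e_def)
      then have "x \<in> K" using e0(2) by (auto simp: dist_commute)
      have "z (r k) \<in> K" using zv(1) frK by blast
      have jt: "1 \<le> j * t" using j1 t(1) by (simp add: field_simps)
      have "y = (1 - 1 / (j * t)) *\<^sub>R z (r k) + (1 / (j * t)) *\<^sub>R x"
        using jt j(2) t(1) by (simp add: x_def scaleR_conv_of_real field_simps)
      moreover have "\<dots> \<in> K"
        using jt by (intro convexD_alt[OF Kc(2) \<open>z (r k) \<in> K\<close> \<open>x \<in> K\<close>]) auto
      ultimately show "y \<in> K" by simp
    qed
    then show False using zv(3)[of "r k"] by (simp add: j_def)
  qed
  then show False by simp
qed

section \<open>Length of the boundary: local lower bound and finiteness\<close>

text \<open>A circle of radius \<open>s < \<tau>\<close> about \<open>\<zeta>\<close> contains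
  \<open>\<zeta> + s * \<nu>\<close> in \<open>K\<close> and \<open>\<zeta> - s * \<nu>\<close>
  outside, hence meets the boundary. So the distance from \<open>\<zeta>\<close>, a 1-Lipschitz
  function, takes every value below \<open>\<tau>\<close> there.\<close>

lemma hausdorff1_outer_frontier_cball_ge:
  assumes "convex K" "\<zeta> \<in> K" and \<nu>: "inward_normal K \<zeta> \<nu>" and h: "0 < h" "\<zeta> + of_real h * \<nu> \<in> K"
    and \<tau>: "0 \<le> \<tau>" "\<tau> \<le> h"
  shows "ennreal \<tau> \<le> hausdorff1_outer (frontier K \<inter> cball \<zeta> \<tau>)"
proof (rule hausdorff1_outer_lipschitz_lower[of "dist \<zeta>"])
  show "\<bar>dist \<zeta> x - dist \<zeta> y\<bar> \<le> dist x y" for x y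
    using dist_triangle[of \<zeta> x y] dist_triangle[of \<zeta> y x] by (simp add: dist_commute)
  show "{0<..<\<tau>} \<subseteq> dist \<zeta> ` (frontier K \<inter> cball \<zeta> \<tau>)"
  proof
    fix s assume s: "s \<in> {0<..<\<tau>}"
    have "\<zeta> + of_real s * \<nu> = (1 - s / h) *\<^sub>R \<zeta> + (s / h) *\<^sub>R (\<zeta> + of_real h * \<nu>)"
      using h(1) by (simp add: scaleR_conv_of_real field_simps)
    also have "\<dots> \<in> K" using s \<tau> h by (intro convexD_alt[OF assms(1,2)]) auto
    finally have "\<zeta> + of_real s * \<nu> \<in> sphere \<zeta> s \<inter> K"
      using s inward_normalD(1)[OF \<nu>] by (simp add: dist_norm norm_mult)
    moreover have "\<zeta> - of_real s * \<nu> \<in> sphere \<zeta> s - K"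
    proof -
      have "Re ((\<zeta> - of_real s * \<nu> - \<zeta>) * cnj \<nu>) = - s"
        using inward_normalD(3)[OF \<nu>] by (simp add: mult.assoc)
      then have "\<zeta> - of_real s * \<nu> \<notin> K" using inward_normalD(2)[OF \<nu>] s by fastforce
      then show ?thesis using s inward_normalD(1)[OF \<nu>] by (simp add: dist_norm norm_mult)
    qed
    moreover have "connected (sphere \<zeta> s)" by (rule connected_sphere) simp
    ultimately have "sphere \<zeta> s \<inter> frontier K \<noteq> {}" using connected_Int_frontier by blast
    then show "s \<in> dist \<zeta> ` (frontier K \<inter> cball \<zeta> \<tau>)" using s by auto
  qed
qed (use \<tau> in auto)

lemma dist_cis_le: "dist (cis s) (cis t) \<le> \<bar>s - t\<bar>"
proof -
  have "(dist (cis s) (cis t))\<^sup>2 = 2 - 2 * cos (s - t)"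
    by (simp only: dist_norm cmod_power2)
       (simp add: cos_diff power2_eq_square algebra_simps; use sin_cos_squared_add3[of s] sin_cos_squared_add3[of t] in linarith)
  also have "\<dots> = (2 * sin ((s - t) / 2))\<^sup>2"
  proof -
    have "2 * ((s - t) / 2) = s - t" by simp
    then show ?thesis using cos_double_sin[of "(s - t) / 2"] by (simp only: power_mult_distrib) simp
  qed
  also have "\<dots> \<le> (s - t)\<^sup>2"
    using abs_sin_x_le_abs_x[of "(s - t) / 2"] by (intro abs_le_square_iff[THEN iffD1]) (simp add: abs_mult)
  finally have "(dist (cis s) (cis t))\<^sup>2 \<le> \<bar>s - t\<bar>\<^sup>2" by simp
  then show ?thesis by (rule power2_le_imp_le) simp
qed

text \<open>The nearest point projection maps a large circle onto the boundary.\<close>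
lemma hausdorff1_outer_frontier_finite:
  assumes K: "convex_domain K" and sm: "smooth_convex K"
  shows "hausdorff1_outer (frontier K) < \<infinity>"
proof -
  have Kc: "compact K" "convex K" "closed K" "K \<noteq> {}"
    using K interior_subset by (auto simp: convex_domain_def compact_imp_closed)
  obtain R where R: "R > 0" "\<And>w. w \<in> K \<Longrightarrow> cmod w \<le> R"
    using compact_imp_bounded[OF Kc(1)] bounded_pos by blast
  define g where "g \<theta> = closest_point K (of_real R * cis \<theta>)" for \<theta>
  have "hausdorff1_outer (frontier K) \<le> ennreal (R * (2 * pi))"
  proof (rule hausdorff1_outer_lipschitz_upper)
    show "dist (g s) (g t) \<le> R * \<bar>s - t\<bar>" for s t
    proof -
      have "dist (g s) (g t) \<le> dist (of_real R * cis s) (of_real R * cis t)"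
        unfolding g_def by (rule closest_point_lipschitz[OF Kc(2,3,4)])
      also have "\<dots> = R * dist (cis s) (cis t)"
        using R(1) by (simp add: dist_norm norm_mult flip: right_diff_distrib)
      finally show ?thesis using mult_left_mono[OF dist_cis_le[of s t], of R] R(1) by linarith
    qed
    show "frontier K \<subseteq> g ` {0..2 * pi}"
    proof
      fix \<zeta> assume \<zeta>: "\<zeta> \<in> frontier K"
      then have "\<zeta> \<in> K" using Kc(3) frontier_subset_closed by blast
      obtain \<nu> where \<nu>: "inward_normal K \<zeta> \<nu>" using smooth_convex_inward_normal[OF sm \<zeta>] .
      \<comment> \<open>Going outward from \<open>\<zeta>\<close> along the normal one reaches the
        circle of radius \<open>R\<close>; the point found there projects back to
        \<open>\<zeta>\<close>, because \<open>K\<close> lies beyond the supporting line.\<close>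
      have "\<exists>t\<ge>0. t \<le> 2 * R \<and> cmod (\<zeta> - of_real t * \<nu>) = R"
      proof (rule IVT')
        show "cmod (\<zeta> - of_real 0 * \<nu>) \<le> R" using R(2)[OF \<open>\<zeta> \<in> K\<close>] by simp
        have "cmod (of_real (2 * R) * \<nu>) - cmod \<zeta> \<le> cmod (\<zeta> - of_real (2 * R) * \<nu>)"
          by (metis norm_minus_commute norm_triangle_ineq2)
        then show "R \<le> cmod (\<zeta> - of_real (2 * R) * \<nu>)"
          using R(1) R(2)[OF \<open>\<zeta> \<in> K\<close>] inward_normalD(1)[OF \<nu>] by (simp add: norm_mult)
      qed (use R(1) in \<open>auto intro!: continuous_intros\<close>)
      then obtain t where t: "0 \<le> t" "cmod (\<zeta> - of_real t * \<nu>) = R" by blast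
      define a where "a = \<zeta> - of_real t * \<nu>"
      have "closest_point K a = \<zeta>"
      proof (rule closest_point_unique[symmetric, OF Kc(2,3) \<open>\<zeta> \<in> K\<close>], rule ballI)
        fix w assume "w \<in> K"
        have "(w - a) * cnj \<nu> = (w - \<zeta>) * cnj \<nu> + of_real t"
          using inward_normalD(3)[OF \<nu>] by (simp add: a_def algebra_simps)
        then have "t \<le> Re ((w - a) * cnj \<nu>)" using inward_normalD(2)[OF \<nu> \<open>w \<in> K\<close>] by simp
        also have "\<dots> \<le> cmod ((w - a) * cnj \<nu>)" by (rule complex_Re_le_cmod)
        also have "\<dots> = dist a w" using inward_normalD(1)[OF \<nu>] by (simp add: norm_mult dist_norm norm_minus_commute)
        finally show "dist a \<zeta> \<le> dist a w"
          using t(1) inward_normalD(1)[OF \<nu>] by (simp add: a_def dist_norm norm_mult)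
      qed
      moreover have "a = of_real R * cis (Arg2pi a)"
        using t(2) unfolding cis_conv_exp a_def[symmetric] by (metis Arg2pi_eq)
      ultimately have "\<zeta> = g (Arg2pi a)" by (simp add: g_def)
      then show "\<zeta> \<in> g ` {0..2 * pi}"
        using Arg2pi_ge_0[of a] Arg2pi_lt_2pi[of a] by auto
    qed
  qed (use R(1) in auto)
  then show ?thesis by (rule le_less_trans) simp
qed

lemma poly_max_on_frontier:
  assumes "compact K" "K \<noteq> {}"
  obtains \<zeta> where "\<zeta> \<in> frontier K" "\<And>w. w \<in> K \<Longrightarrow> cmod (poly p w) \<le> cmod (poly p \<zeta>)"
proof -
  have "K \<noteq> UNIV" using compact_imp_bounded[OF assms(1)] not_bounded_UNIV by auto
  then have "frontier K \<noteq> {}" using assms(2) by (simp add: frontier_eq_empty)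
  then have "\<exists>\<zeta>\<in>frontier K. \<forall>w\<in>frontier K. cmod (poly p w) \<le> cmod (poly p \<zeta>)"
    by (intro continuous_attains_sup compact_frontier assms(1) continuous_on_norm continuous_intros)
  then obtain \<zeta> where \<zeta>: "\<zeta> \<in> frontier K" "\<And>w. w \<in> frontier K \<Longrightarrow> cmod (poly p w) \<le> cmod (poly p \<zeta>)"
    by blast
  have "cmod (poly p w) \<le> cmod (poly p \<zeta>)" if "w \<in> K" for w
  proof (rule maximum_modulus_frontier[of "poly p" K])
    show "poly p holomorphic_on interior K" "continuous_on (closure K) (poly p)"
      by (intro holomorphic_intros continuous_intros)+
    show "bounded K" by (rule compact_imp_bounded[OF assms(1)])
  qed (fact \<zeta>(2) that)+
  then show ?thesis by (rule that[OF \<zeta>(1)])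
qed

section \<open>Norms on the boundary\<close>

text \<open>The \<open>q\<close>-th power of the norm is kept in \<open>ennreal\<close>, because
  \<open>enn2real\<close> sends infinity to 0 and is monotone only below infinity.\<close>

definition Lq_integral :: "complex set \<Rightarrow> real \<Rightarrow> (complex \<Rightarrow> complex) \<Rightarrow> ennreal" where
  "Lq_integral K q f = (\<integral>\<^sup>+ z\<in>frontier K. ennreal (cmod (f z) powr q) \<partial>hausdorff1)"

lemma Lq_boundary_norm_eq: "Lq_boundary_norm K q f = enn2real (Lq_integral K q f) powr (1 / q)"
  by (simp add: Lq_boundary_norm_def Lq_integral_def)

lemma frontier_in_sets_borel [measurable]: "frontier K \<in> sets borel"
  using frontier_closed by (rule borel_closed)

lemma poly_borel_measurable [measurable]: "poly (p :: complex poly) \<in> borel_measurable borel"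
  by (intro borel_measurable_continuous_onI continuous_intros)

lemma Lq_integral_le:
  assumes "0 \<le> q" "\<And>z. z \<in> frontier K \<Longrightarrow> cmod (f z) \<le> M"
  shows "Lq_integral K q f \<le> ennreal (M powr q) * hausdorff1_outer (frontier K)"
proof -
  have "Lq_integral K q f \<le> (\<integral>\<^sup>+ z. ennreal (M powr q) * indicator (frontier K) z \<partial>hausdorff1)"
    unfolding Lq_integral_def using assms
    by (intro nn_integral_mono) (auto simp: indicator_def intro!: ennreal_leI powr_mono2)
  also have "\<dots> = ennreal (M powr q) * hausdorff1_outer (frontier K)"
    by (subst nn_integral_cmult_indicator) (simp_all add: emeasure_hausdorff1)
  finally show ?thesis .
qed

lemma Lq_integral_ge:
  assumes "0 \<le> q" "0 \<le> m" "A \<subseteq> frontier K" "A \<in> sets borel" "\<And>z. z \<in> A \<Longrightarrow> m \<le> cmod (f z)"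
  shows "ennreal (m powr q) * hausdorff1_outer A \<le> Lq_integral K q f"
proof -
  have "ennreal (m powr q) * hausdorff1_outer A = (\<integral>\<^sup>+ z. ennreal (m powr q) * indicator A z \<partial>hausdorff1)"
    using assms(4) by (subst nn_integral_cmult_indicator) (simp_all add: emeasure_hausdorff1)
  also have "\<dots> \<le> Lq_integral K q f"
    unfolding Lq_integral_def using assms
    by (intro nn_integral_mono) (auto simp: indicator_def intro!: ennreal_leI powr_mono2)
  finally show ?thesis .
qed

lemma Lq_integral_poly_le_dichotomy:
  assumes q: "0 \<le> q" and c: "0 \<le> c" and b: "0 \<le> b"
    and dich: "\<And>z. z \<in> frontier K \<Longrightarrow> cmod (poly p z) \<le> c * cmod (poly r z) \<or> cmod (poly p z) \<le> b"
  shows "Lq_integral K q (poly p) \<le> ennreal (c powr q) * Lq_integral K q (poly r)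
    + ennreal (b powr q) * hausdorff1_outer (frontier K)"
proof -
  have "Lq_integral K q (poly p) \<le> (\<integral>\<^sup>+ z. ennreal (c powr q) * (ennreal (cmod (poly r z) powr q) * indicator (frontier K) z)
      + ennreal (b powr q) * indicator (frontier K) z \<partial>hausdorff1)"
    unfolding Lq_integral_def
  proof (rule nn_integral_mono)
    fix z
    show "ennreal (cmod (poly p z) powr q) * indicator (frontier K) z
      \<le> ennreal (c powr q) * (ennreal (cmod (poly r z) powr q) * indicator (frontier K) z)
      + ennreal (b powr q) * indicator (frontier K) z"
    proof (cases "z \<in> frontier K")
      case True
      have "cmod (poly p z) powr q \<le> c powr q * cmod (poly r z) powr q + b powr q"
        using dich[OF True]
      proof
        assume "cmod (poly p z) \<le> c * cmod (poly r z)"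
        then have "cmod (poly p z) powr q \<le> (c * cmod (poly r z)) powr q" by (intro powr_mono2 q) auto
        also have "\<dots> = c powr q * cmod (poly r z) powr q" using c by (simp add: powr_mult)
        finally show ?thesis by (rule add_increasing2[rotated]) simp
      next
        assume "cmod (poly p z) \<le> b"
        then have "cmod (poly p z) powr q \<le> b powr q" by (intro powr_mono2 q) auto
        then show ?thesis by (rule add_increasing[rotated]) simp
      qed
      then have "ennreal (cmod (poly p z) powr q) \<le> ennreal (c powr q * cmod (poly r z) powr q + b powr q)"
        by (rule ennreal_leI)
      with True show ?thesis by (simp add: ennreal_mult)
    qed simp
  qed
  also have "\<dots> = ennreal (c powr q) * Lq_integral K q (poly r)
    + ennreal (b powr q) * hausdorff1_outer (frontier K)"
  proof -
    have [measurable]: "frontier K \<in> sets hausdorff1" by simp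
    show ?thesis
      unfolding Lq_integral_def
      by (subst nn_integral_add) (simp_all add: nn_integral_cmult nn_integral_cmult_indicator emeasure_hausdorff1)
  qed
  finally show ?thesis .
qed

lemma poly_dist_le_pderiv:
  fixes p :: "complex poly"
  assumes "convex K" "\<And>w. w \<in> K \<Longrightarrow> cmod (poly (pderiv p) w) \<le> B" "x \<in> K" "y \<in> K"
  shows "cmod (poly p x - poly p y) \<le> B * cmod (x - y)"
  by (rule field_differentiable_bound[OF assms(1) _ assms(2-4)])
     (auto intro: has_field_derivative_at_within poly_DERIV)

text \<open>Together with \<open>powr_inverse_ge\<close> this replaces \<open>q\<close>-th roots of
  constants by bounds free of \<open>q\<close>, so that the final constant depends on
  \<open>K\<close> only.\<close>

lemma powr_inverse_le_max_1:
  assumes "0 \<le> x" "1 \<le> (q::real)"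
  shows "x powr (1 / q) \<le> max 1 x"
proof (cases "x \<le> 1")
  case True
  then have "x powr (1/q) \<le> 1 powr (1/q)" using assms by (intro powr_mono2) auto
  then show ?thesis by simp
next
  case False
  then have "x powr (1/q) \<le> x powr 1" using assms by (intro powr_mono) auto
  then show ?thesis using False by simp
qed

lemma powr_inverse_ge:
  assumes "0 \<le> x" "x \<le> 1" "1 \<le> (q::real)"
  shows "x \<le> x powr (1 / q)"
  using powr_mono'[of "1/q" 1 x] assms by (cases "x = 0") auto


text \<open>The crude comparison for small degrees, with a polynomial for \<open>f\<close> and its
  derivative for \<open>g\<close>: the norm of \<open>f\<close> is bounded by supremum and length,
  that of \<open>g\<close> from below through a piece of length \<open>\<tau>\<close> where it
  exceeds half its maximum \<open>M'\<close>.\<close>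

lemma Lq_norm_pderiv_ge_of_sup:
  assumes q: "1 \<le> q" and H: "0 \<le> H" "hausdorff1_outer (frontier K) = ennreal H"
    and M: "\<And>z. z \<in> frontier K \<Longrightarrow> cmod (f z) \<le> M" and MM': "M \<le> d * M'" and d: "0 < d" and M': "0 \<le> M'"
    and \<tau>: "0 < \<tau>" "\<tau> \<le> 1" and g: "ennreal ((M' / 2) powr q) * ennreal \<tau> \<le> Lq_integral K q g"
    and fin: "Lq_integral K q g < \<infinity>"
  shows "\<tau> / (2 * d * max 1 H) * Lq_boundary_norm K q f \<le> Lq_boundary_norm K q g"
proof (cases "M \<ge> 0")
  case True
  have "enn2real (Lq_integral K q f) \<le> M powr q * H"
    using Lq_integral_le[of q K f M] q M H by (intro enn2real_leI) (auto simp: ennreal_mult)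
  then have "Lq_boundary_norm K q f \<le> (M powr q * H) powr (1/q)"
    unfolding Lq_boundary_norm_eq using q by (intro powr_mono2) auto
  also have "\<dots> = M * H powr (1/q)" using True H q by (simp add: powr_mult powr_powr)
  also have "\<dots> \<le> (d * M') * max 1 H"
    using True H q MM' d M' by (intro mult_mono powr_inverse_le_max_1) auto
  finally have up: "Lq_boundary_norm K q f \<le> (d * M') * max 1 H" .
  have "(M' / 2) powr q * \<tau> \<le> enn2real (Lq_integral K q g)"
    using enn2real_mono[OF g] fin \<tau> by (simp add: enn2real_mult less_top)
  then have "((M' / 2) powr q * \<tau>) powr (1/q) \<le> Lq_boundary_norm K q g"
    unfolding Lq_boundary_norm_eq using q \<tau> by (intro powr_mono2) auto
  moreover have "((M' / 2) powr q * \<tau>) powr (1/q) = M' / 2 * \<tau> powr (1/q)"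
    using M' \<tau> q by (simp add: powr_mult powr_powr)
  moreover have "M' / 2 * \<tau> \<le> M' / 2 * \<tau> powr (1/q)"
    using powr_inverse_ge[of \<tau> q] \<tau> q M' by (intro mult_left_mono) auto
  ultimately have lo: "M' / 2 * \<tau> \<le> Lq_boundary_norm K q g" by simp
  have "\<tau> / (2 * d * max 1 H) * Lq_boundary_norm K q f \<le> \<tau> / (2 * d * max 1 H) * ((d * M') * max 1 H)"
    using up \<tau> d by (intro mult_left_mono) auto
  also have "\<dots> = M' / 2 * \<tau>"
    using d by (simp add: max_def)
  also note lo
  finally show ?thesis .
next
  case False
  then have "frontier K = {}" using M norm_ge_zero order_trans by (metis equals0I)
  then have "Lq_boundary_norm K q f = 0" using q by (simp add: Lq_boundary_norm_def)
  then show ?thesis by (simp add: Lq_boundary_norm_def)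
qed

text \<open>Where the derivative is small, \<open>p\<close> is too small to contribute more than half of its norm.\<close>
lemma Lq_norm_pderiv_ge_of_dichotomy:
  assumes q: "1 \<le> q" and H: "0 \<le> H" "hausdorff1_outer (frontier K) = ennreal H"
    and c: "0 < c" and b: "0 \<le> b" and M: "0 \<le> M"
    and dich: "\<And>z. z \<in> frontier K \<Longrightarrow> c * cmod (poly p z) \<le> cmod (poly r z) \<or> cmod (poly p z) \<le> b * M"
    and \<tau>: "0 \<le> \<tau>" and g: "ennreal ((M / 2) powr q) * ennreal \<tau> \<le> Lq_integral K q (poly p)"
    and b\<tau>: "2 * b \<le> 1" "4 * b * H \<le> \<tau>"
    and fin: "Lq_integral K q (poly p) < \<infinity>" "Lq_integral K q (poly r) < \<infinity>"
  shows "c / 2 * Lq_boundary_norm K q (poly p) \<le> Lq_boundary_norm K q (poly r)"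
proof -
  define I J where "I = enn2real (Lq_integral K q (poly p))" and "J = enn2real (Lq_integral K q (poly r))"
  have IJ: "Lq_integral K q (poly p) = ennreal I" "Lq_integral K q (poly r) = ennreal J" "0 \<le> I" "0 \<le> J"
    using fin by (auto simp: I_def J_def)
  have dich': "cmod (poly p z) \<le> (1/c) * cmod (poly r z) \<or> cmod (poly p z) \<le> b * M"
    if "z \<in> frontier K" for z using dich[OF that] c by (auto simp: field_simps)
  have "ennreal I \<le> ennreal ((1/c) powr q) * ennreal J + ennreal ((b * M) powr q) * ennreal H"
    using Lq_integral_poly_le_dichotomy[of q "1/c" "b * M" K p r, OF _ _ _ dich'] q c b M
    by (simp add: IJ H)
  then have "ennreal I \<le> ennreal ((1/c) powr q * J + (b * M) powr q * H)"
    using IJ H by (simp add: ennreal_mult)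
  then have "I \<le> (1/c) powr q * J + (b * M) powr q * H"
    by (subst (asm) ennreal_le_iff) (use IJ H in auto)
  moreover have "(b * M) powr q * H \<le> I / 2"
  proof -
    have "(b * M) powr q * H = (2 * b) powr q * H * (M / 2) powr q"
      using b M by (simp flip: powr_mult)
    also have "(2 * b) powr q \<le> (2 * b) powr 1"
      using b b\<tau> q by (intro powr_mono') auto
    also have "(2 * b) powr 1 * H \<le> \<tau> / 2" using b b\<tau>(2) by simp
    also have "\<tau> / 2 * (M / 2) powr q \<le> I / 2"
    proof -
      have "ennreal ((M / 2) powr q * \<tau>) \<le> ennreal I" using g IJ \<tau> by (simp add: ennreal_mult)
      then have "(M / 2) powr q * \<tau> \<le> I" by (subst (asm) ennreal_le_iff) (use IJ in auto)
      then show ?thesis by (simp add: mult.commute)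
    qed
    finally show ?thesis using H by (simp add: mult_right_mono)
  qed
  ultimately have "I \<le> 2 * ((1/c) powr q * J)" by simp
  then have "I powr (1/q) \<le> (2 * ((1/c) powr q * J)) powr (1/q)"
    using q IJ by (intro powr_mono2) auto
  also have "\<dots> = 2 powr (1/q) * ((1/c) * J powr (1/q))"
    using q c IJ by (simp add: powr_mult powr_powr)
  also have "\<dots> \<le> 2 * ((1/c) * J powr (1/q))"
    using powr_inverse_le_max_1[of 2 q] q c by (intro mult_right_mono) auto
  finally show ?thesis
    unfolding Lq_boundary_norm_eq I_def[symmetric] J_def[symmetric] using c by (simp add: field_simps)
qed

text \<open>Around a maximum point the polynomial stays above half its maximum within the radius
  \<open>\<delta> / (4 * E ^ n)\<close>, and the boundary has at least that length inside this
  ball.\<close>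

lemma Lq_integral_poly_ge_sup:
  assumes K: "convex K" "compact K" and \<zeta>: "\<zeta> \<in> frontier K" "inward_normal K \<zeta> \<nu>"
    and h: "0 < h" "\<zeta> + of_real h * \<nu> \<in> K"
    and deg: "degree p \<le> n" and max: "\<And>w. w \<in> K \<Longrightarrow> cmod (poly p w) \<le> cmod (poly p \<zeta>)"
    and E: "1 \<le> E" and \<delta>: "0 < \<delta>" "\<delta> \<le> h" "4 * \<delta> \<le> (E + 1/E - 2) * h" and q: "0 \<le> q"
  shows "ennreal ((cmod (poly p \<zeta>) / 2) powr q) * ennreal (\<delta> / (4 * E ^ n)) \<le> Lq_integral K q (poly p)"
proof -
  define \<tau> where "\<tau> = \<delta> / (4 * E ^ n)"
  have En: "1 \<le> E ^ n" using E by simp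
  then have "\<tau> \<le> \<delta> / 1" using \<delta> unfolding \<tau>_def by (intro divide_left_mono) auto
  then have \<tau>: "0 \<le> \<tau>" "\<tau> \<le> h" using \<delta> En by (auto simp: \<tau>_def)
  have \<zeta>K: "\<zeta> \<in> K" using \<zeta>(1) frontier_subset_compact[OF K(2)] by blast
  have dh: "dist \<zeta> (\<zeta> + of_real h * \<nu>) = h"
    using h(1) inward_normalD(1)[OF \<zeta>(2)] by (simp add: dist_norm norm_mult)
  have "ennreal ((cmod (poly p \<zeta>) / 2) powr q) * ennreal \<tau>
      \<le> ennreal ((cmod (poly p \<zeta>) / 2) powr q) * hausdorff1_outer (frontier K \<inter> cball \<zeta> \<tau>)"
    by (intro mult_left_mono hausdorff1_outer_frontier_cball_ge[OF K(1) \<zeta>K \<zeta>(2) h \<tau>]) simp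
  also have "\<dots> \<le> Lq_integral K q (poly p)"
  proof (rule Lq_integral_ge[OF q])
    fix z assume z: "z \<in> frontier K \<inter> cball \<zeta> \<tau>"
    show "cmod (poly p \<zeta>) / 2 \<le> cmod (poly p z)"
    proof (rule poly_half_max_near_segment_end[OF deg])
      show "cmod (poly p y) \<le> cmod (poly p \<zeta>)" if "y \<in> closed_segment \<zeta> (\<zeta> + of_real h * \<nu>)" for y
        using that closed_segment_subset[OF \<zeta>K h(2) K(1)] by (intro max) blast
      show "\<zeta> \<noteq> \<zeta> + of_real h * \<nu>" using dh h(1) by auto
      show "4 * \<delta> \<le> (E + 1 / E - 2) * dist \<zeta> (\<zeta> + of_real h * \<nu>)" using \<delta>(3) dh by simp
      show "dist z \<zeta> \<le> \<delta> / (4 * E ^ n)" using z by (simp add: \<tau>_def dist_commute)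
    qed (use E \<delta> in auto)
  qed auto
  finally show ?thesis by (simp add: \<tau>_def)
qed

lemma Lq_integral_poly_finite:
  assumes "compact K" "K \<noteq> {}" "hausdorff1_outer (frontier K) < \<infinity>" "0 \<le> q"
  shows "Lq_integral K q (poly p) < \<infinity>"
proof -
  obtain \<zeta> where "\<And>w. w \<in> K \<Longrightarrow> cmod (poly p w) \<le> cmod (poly p \<zeta>)"
    using poly_max_on_frontier[OF assms(1,2)] by metis
  then have "Lq_integral K q (poly p) \<le> ennreal (cmod (poly p \<zeta>) powr q) * hausdorff1_outer (frontier K)"
    using frontier_subset_compact[OF assms(1)] by (intro Lq_integral_le assms) blast
  also have "\<dots> < \<infinity>" using assms(3) by (simp add: ennreal_mult_less_top)
  finally show ?thesis .
qed

section \<open>Choice of the constants and conclusion\<close>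

text \<open>All constants are fixed before \<open>q\<close>, \<open>n\<close> and \<open>p\<close>.
  Positivity of the norm of \<open>p\<close> is part of the claim because a quotient with
  denominator 0 would be 0.\<close>

lemma Lq_norm_pderiv_ge:
  assumes K: "convex_domain K" and sm: "smooth_convex K"
  shows "\<exists>C>0. \<forall>q n p. 1 \<le> q \<and> 1 \<le> n \<and> p \<in> polys_in n K \<longrightarrow>
    0 < Lq_boundary_norm K q (poly p) \<and>
    C * real n * Lq_boundary_norm K q (poly p) \<le> Lq_boundary_norm K q (poly (pderiv p))"
proof -
  have Kc: "compact K" "convex K" "interior K \<noteq> {}" "K \<noteq> {}"
    using K interior_subset by (auto simp: convex_domain_def)
  have frK: "frontier K \<subseteq> K" by (rule frontier_subset_compact[OF Kc(1)])
  obtain h \<rho>0 where h: "0 < h" and \<rho>0: "0 < \<rho>0"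
    and disc0: "\<And>\<zeta> \<nu>. \<zeta> \<in> frontier K \<Longrightarrow> inward_normal K \<zeta> \<nu> \<Longrightarrow> cball (\<zeta> + of_real h * \<nu>) \<rho>0 \<subseteq> K"
    using smooth_convex_uniform_disc[OF K sm] by metis
  have hK: "\<zeta> + of_real h * \<nu> \<in> K" if "\<zeta> \<in> frontier K" "inward_normal K \<zeta> \<nu>" for \<zeta> \<nu>
    using disc0[OF that] \<rho>0 by auto
  define d where "d = diameter K"
  have dist_d: "dist w z \<le> d" if "w \<in> K" "z \<in> K" for w z
    unfolding d_def using that compact_imp_bounded[OF Kc(1)] by (rule diameter_bounded_bound[rotated])
  have hd: "h \<le> d"
  proof -
    obtain \<zeta> where \<zeta>: "\<zeta> \<in> frontier K" using poly_max_on_frontier[OF Kc(1,4)] by metis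
    obtain \<nu> where \<nu>: "inward_normal K \<zeta> \<nu>" using smooth_convex_inward_normal[OF sm \<zeta>] .
    have "dist (\<zeta> + of_real h * \<nu>) \<zeta> \<le> d" using hK[OF \<zeta> \<nu>] \<zeta> frK by (intro dist_d) auto
    then show ?thesis using h inward_normalD(1)[OF \<nu>] by (simp add: dist_norm norm_mult)
  qed
  then have d: "0 < d" using h by simp
  define \<rho> where "\<rho> = min \<rho>0 (min d (h\<^sup>2 / (20 * d)))"
  have \<rho>: "0 < \<rho>" "\<rho> \<le> \<rho>0" "\<rho> \<le> d" "20 * d * \<rho> \<le> h\<^sup>2"
  proof -
    have "\<rho> \<le> h\<^sup>2 / (20 * d)" by (simp add: \<rho>_def)
    then show "20 * d * \<rho> \<le> h\<^sup>2" using d by (simp add: field_simps)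
  qed (use \<rho>0 d h in \<open>auto simp: \<rho>_def\<close>)
  define s where "s = sqrt (1 + h\<^sup>2 / (12 * d\<^sup>2))"
  have s: "1 < s" "s\<^sup>2 = 1 + h\<^sup>2 / (12 * d\<^sup>2)" using h d by (auto simp: s_def)
  obtain N0 where "d * s\<^sup>2 / \<rho> < s ^ N0" using real_arch_pow[OF s(1)] by blast
  moreover have "s ^ N0 \<le> s ^ Suc N0" using s(1) by (intro power_increasing) auto
  ultimately obtain N where N: "0 < N" "d * s\<^sup>2 / \<rho> \<le> s ^ N" by (metis less_eq_real_def order_trans zero_less_Suc)
  define c where "c = h / (4 * d\<^sup>2 * real N)"
  have c: "0 < c" using h d N by (simp add: c_def)
  \<comment> \<open>With this choice the bound \<open>1 / s ^ n\<close> for the small values of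
    \<open>p\<close> is \<open>E ^ n\<close> times smaller than the decay \<open>1 / E ^ n\<close>
    of the length on which \<open>p\<close> is large.\<close>
  define E where "E = sqrt s"
  have E: "1 < E" "E\<^sup>2 = s" using s(1) by (auto simp: E_def)
  have "(E - 1)\<^sup>2 / E = E + 1/E - 2" using E(1) by (simp add: field_simps power2_eq_square)
  moreover have "0 < (E - 1)\<^sup>2 / E" using E(1) by simp
  ultimately have E2: "0 < E + 1/E - 2" by simp
  define \<delta> where "\<delta> = min 1 (min h ((E + 1/E - 2) * h / 4))"
  have \<delta>: "0 < \<delta>" "\<delta> \<le> 1" "\<delta> \<le> h" "4 * \<delta> \<le> (E + 1/E - 2) * h"
  proof -
    have "\<delta> \<le> (E + 1/E - 2) * h / 4" unfolding \<delta>_def by (intro min.coboundedI2 order_refl)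
    then show "4 * \<delta> \<le> (E + 1/E - 2) * h" by simp
    show "0 < \<delta>" using h mult_pos_pos[OF E2 h] by (simp add: \<delta>_def)
  qed (auto simp: \<delta>_def)
  have Hfin: "hausdorff1_outer (frontier K) < \<infinity>" by (rule hausdorff1_outer_frontier_finite[OF K sm])
  define H where "H = enn2real (hausdorff1_outer (frontier K))"
  have H: "0 \<le> H" "hausdorff1_outer (frontier K) = ennreal H" using Hfin by (auto simp: H_def)
  \<comment> \<open>From degree \<open>m\<close> on, \<open>b = 1 / s ^ n\<close> satisfies both
    smallness conditions of \<open>Lq_norm_pderiv_ge_of_dichotomy\<close>.\<close>
  obtain m where m: "max 2 (16 * H / \<delta>) < E ^ m" using real_arch_pow[OF E(1)] by blast
  \<comment> \<open>The first entry serves \<open>n >= m\<close>. For \<open>n < m\<close> the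
    length \<open>\<delta> / (4 * E ^ n)\<close> is at least its value at \<open>m\<close>, and
    division by \<open>real m + 1\<close> absorbs the factor \<open>n\<close>.\<close>
  define C where "C = min (c / 2) (\<delta> / (4 * E ^ m) / (2 * d * max 1 H) / (real m + 1))"
  have "0 < C" using c \<delta>(1) E(1) d by (simp add: C_def)
  moreover have "0 < Lq_boundary_norm K q (poly p) \<and>
      C * real n * Lq_boundary_norm K q (poly p) \<le> Lq_boundary_norm K q (poly (pderiv p))"
    if q: "1 \<le> q" and n: "1 \<le> n" and p: "p \<in> polys_in n K" for q n p
  proof -
    have deg: "degree p = n" and zeros: "\<And>z. poly p z = 0 \<Longrightarrow> z \<in> K"
      using p by (auto simp: polys_in_def)
    have fin: "Lq_integral K q (poly r) < \<infinity>" for r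
      using Lq_integral_poly_finite[OF Kc(1,4) Hfin] q by simp
    define \<tau> where "\<tau> = \<delta> / (4 * E ^ n)"
    have lower: "ennreal ((cmod (poly r \<zeta>) / 2) powr q) * ennreal \<tau> \<le> Lq_integral K q (poly r)"
      if deg_r: "degree r \<le> n" "\<zeta> \<in> frontier K" "\<And>w. w \<in> K \<Longrightarrow> cmod (poly r w) \<le> cmod (poly r \<zeta>)" for r \<zeta>
    proof -
      obtain \<nu> where \<nu>: "inward_normal K \<zeta> \<nu>" using smooth_convex_inward_normal[OF sm deg_r(2)] .
      show ?thesis
        unfolding \<tau>_def using E(1) q
        by (intro Lq_integral_poly_ge_sup[OF Kc(2,1) deg_r(2) \<nu> h hK[OF deg_r(2) \<nu>] deg_r(1,3)] \<delta>) auto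
    qed
    obtain \<zeta>0 where \<zeta>0: "\<zeta>0 \<in> frontier K" "\<And>w. w \<in> K \<Longrightarrow> cmod (poly p w) \<le> cmod (poly p \<zeta>0)"
      using poly_max_on_frontier[OF Kc(1,4)] by metis
    define M where "M = cmod (poly p \<zeta>0)"
    have lowerM: "ennreal ((M / 2) powr q) * ennreal \<tau> \<le> Lq_integral K q (poly p)"
      unfolding M_def by (rule lower[OF _ \<zeta>0]) (simp add: deg)
    have En: "1 \<le> E ^ n" using E(1) by simp
    have \<tau>: "0 < \<tau>" "\<tau> \<le> 1"
    proof -
      have "\<delta> / (4 * E ^ n) \<le> 1 / 1" using \<delta> En by (intro frac_le) auto
      then show "\<tau> \<le> 1" by (simp add: \<tau>_def)
    qed (use \<delta> En in \<open>simp add: \<tau>_def\<close>)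
    have M: "0 < M"
    proof (rule ccontr)
      assume "\<not> 0 < M"
      then have "K \<subseteq> {z. poly p z = 0}" using \<zeta>0(2) by (force simp: M_def)
      moreover have "p \<noteq> 0" using deg n by auto
      ultimately have "finite K" using poly_roots_finite finite_subset by blast
      then show False using Kc(3) empty_interior_finite by blast
    qed
    have "0 < ennreal ((M / 2) powr q) * ennreal \<tau>"
      using M \<tau>(1) by (simp add: ennreal_zero_less_mult_iff)
    then have "0 < enn2real (Lq_integral K q (poly p))"
      using lowerM fin[of p] by (auto simp: enn2real_positive_iff)
    then have pos: "0 < Lq_boundary_norm K q (poly p)" by (simp add: Lq_boundary_norm_eq)
    have "C * real n * Lq_boundary_norm K q (poly p) \<le> Lq_boundary_norm K q (poly (pderiv p))"
    proof (cases "m \<le> n")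
      case True
      have Em: "max 2 (16 * H / \<delta>) \<le> E ^ n"
        using m power_increasing[OF True, of E] E(1) by linarith
      have sE: "s ^ n = E ^ n * E ^ n"
        unfolding E(2)[symmetric] by (simp add: power2_eq_square power_mult_distrib)
      have "c * real n / 2 * Lq_boundary_norm K q (poly p) \<le> Lq_boundary_norm K q (poly (pderiv p))"
      proof (rule Lq_norm_pderiv_ge_of_dichotomy[OF q H _ _ _ _ _ lowerM _ _ fin fin])
        show "c * real n * cmod (poly p z) \<le> cmod (poly (pderiv p) z) \<or> cmod (poly p z) \<le> 1 / s ^ n * M"
          if z: "z \<in> frontier K" for z
        proof -
          obtain \<nu> where \<nu>: "inward_normal K z \<nu>" using smooth_convex_inward_normal[OF sm z] .
          have disc: "cball (z + of_real h * \<nu>) \<rho> \<subseteq> K"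
            using disc0[OF z \<nu>] \<rho>(2) by (meson order_trans subset_cball)
          have "c * real (degree p) * cmod (poly p z) \<le> cmod (poly (pderiv p) z) \<or>
              (\<exists>y\<in>K. s ^ degree p * cmod (poly p z) \<le> cmod (poly p y))"
            unfolding c_def using s(1) z frK
            by (intro log_deriv_ge_or_growth[OF zeros inward_normalD(1,2)[OF \<nu>] disc d dist_d h hd \<rho>(1,3,4) _ s(2) N]) auto
          then show ?thesis
          proof (elim disjE bexE)
            fix y assume "y \<in> K" "s ^ degree p * cmod (poly p z) \<le> cmod (poly p y)"
            then have "s ^ n * cmod (poly p z) \<le> M" using \<zeta>0(2)[of y] by (simp add: M_def deg)
            then show ?thesis using s(1) by (simp add: field_simps)
          qed (simp add: deg)
        qed
        have En2: "2 \<le> E ^ n" using Em by simp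
        have "2 * 1 \<le> E ^ n * E ^ n" using En2 En by (intro mult_mono) auto
        then show "2 * (1 / s ^ n) \<le> 1" by (simp add: sE)
        have "16 * H \<le> \<delta> * E ^ n" using Em \<delta>(1) by (simp add: field_simps)
        then have "16 * H / (4 * (E ^ n * E ^ n)) \<le> \<delta> * E ^ n / (4 * (E ^ n * E ^ n))"
          using E(1) by (intro divide_right_mono) auto
        then show "4 * (1 / s ^ n) * H \<le> \<tau>" using E(1) by (simp add: sE \<tau>_def)
      qed (use c n s(1) M \<tau> in auto)
      moreover have "C * real n \<le> c * real n / 2"
        using mult_right_mono[of C "c / 2" "real n"] by (simp add: C_def)
      ultimately show ?thesis
        using mult_right_mono[of "C * real n" "c * real n / 2" "Lq_boundary_norm K q (poly p)"] pos by linarith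
    next
      case False
      obtain \<zeta>1 where \<zeta>1: "\<zeta>1 \<in> frontier K" "\<And>w. w \<in> K \<Longrightarrow> cmod (poly (pderiv p) w) \<le> cmod (poly (pderiv p) \<zeta>1)"
        using poly_max_on_frontier[OF Kc(1,4)] by metis
      define M' where "M' = cmod (poly (pderiv p) \<zeta>1)"
      have lower': "ennreal ((M' / 2) powr q) * ennreal \<tau> \<le> Lq_integral K q (poly (pderiv p))"
        unfolding M'_def using deg by (intro lower \<zeta>1) (auto simp: degree_pderiv)
      \<comment> \<open>Since \<open>n >= 1\<close> there is a zero of \<open>p\<close>, and it lies
        in \<open>K\<close>; from it \<open>p\<close> can grow to \<open>M\<close> over a distance
        of at most \<open>d\<close> only if \<open>M <= d * M'\<close>.\<close>
      have "\<not> constant (poly p)" using deg n by (simp add: constant_degree)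
      then obtain x where x: "poly p x = 0" using fundamental_theorem_of_algebra by blast
      have "\<zeta>0 \<in> K" using \<zeta>0(1) frK by blast
      then have "cmod (poly p \<zeta>0 - poly p x) \<le> M' * cmod (\<zeta>0 - x)"
        using \<zeta>1(2) zeros[OF x] by (intro poly_dist_le_pderiv[OF Kc(2)]) (auto simp: M'_def)
      also have "\<dots> \<le> M' * d"
        using dist_d[OF \<open>\<zeta>0 \<in> K\<close> zeros[OF x]] by (intro mult_left_mono) (auto simp: M'_def dist_norm)
      finally have "M \<le> d * M'" using x by (simp add: M_def mult.commute)
      then have *: "\<tau> / (2 * d * max 1 H) * Lq_boundary_norm K q (poly p) \<le> Lq_boundary_norm K q (poly (pderiv p))"
        using frK \<zeta>0(2) unfolding M_def
        by (intro Lq_norm_pderiv_ge_of_sup[OF q H _ _ d _ \<tau> lower' fin]) (auto simp: M'_def)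
      have "C * real n \<le> \<delta> / (4 * E ^ m) / (2 * d * max 1 H) / (real m + 1) * (real m + 1)"
        using False \<delta>(1) E(1) d \<open>0 < C\<close> by (intro mult_mono) (auto simp: C_def)
      also have "\<dots> = \<delta> / (4 * E ^ m) / (2 * d * max 1 H)" by simp
      also have "\<dots> \<le> \<tau> / (2 * d * max 1 H)"
        unfolding \<tau>_def using False \<delta>(1) E(1) d
        by (intro divide_right_mono divide_left_mono mult_left_mono power_increasing) auto
      finally show ?thesis using * mult_right_mono[of "C * real n" "\<tau> / (2 * d * max 1 H)" "Lq_boundary_norm K q (poly p)"] pos
        by linarith
    qed
    with pos show ?thesis by blast
  qed
  ultimately show ?thesis by blast
qed

theorem theorem1:
  fixes K :: "complex set"
  assumes "convex_domain K" and "smooth_convex K"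
  shows "\<exists>C>0. \<forall>q::real. 1 \<le> q \<longrightarrow>
           (\<forall>n::nat. n \<ge> 1 \<longrightarrow> oscillation_factor n q K > C * real n)"
proof -
  obtain C where C: "0 < C" and bound: "\<And>q n p. 1 \<le> q \<Longrightarrow> 1 \<le> n \<Longrightarrow> p \<in> polys_in n K \<Longrightarrow>
    0 < Lq_boundary_norm K q (poly p) \<and>
    C * real n * Lq_boundary_norm K q (poly p) \<le> Lq_boundary_norm K q (poly (pderiv p))"
    using Lq_norm_pderiv_ge[OF assms] by blast
  \<comment> \<open>Passing to the infimum preserves only the weak inequality; halving the constant
    restores strictness.\<close>
  have "C / 2 * real n < oscillation_factor n q K" if q: "1 \<le> q" and n: "1 \<le> n" for q n
  proof -
    obtain x where x: "x \<in> K" using assms(1) interior_subset by (fastforce simp: convex_domain_def)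
    \<comment> \<open>The infimum of an empty set of reals would say nothing, so a member is
      exhibited.\<close>
    have "[:- x, 1:] ^ n \<in> polys_in n K"
      using x n by (auto simp: polys_in_def degree_linear_power)
    then have "C * real n \<le> oscillation_factor n q K"
      unfolding oscillation_factor_def
      using bound[OF q n] by (intro cINF_greatest) (auto simp: pos_le_divide_eq)
    moreover have "C / 2 * real n < C * real n" using C n by simp
    ultimately show ?thesis by linarith
  qed
  then show ?thesis using C by (intro exI[of _ "C / 2"]) auto
qed

end
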